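(* For every fixed integer $q\ge2$ and all finite connected graphs $G,H$, $$\Phi_{C_q(G)}=\Phi_{C_q(H)}\quad\Longleftrightarrow\quad X_G=X_H.$$
   Context: All graphs are finite, simple and undirected; connected graphs have at least one vertex. For a graph $G=(V,E)$, the chromatic symmetric function is $X_G=\sum_{\kappa}\prod_{v\in V}x_{\kappa(v)}$, the sum over all proper colorings $\kappa\colon V\to\{1,2,3,\dots\}$ (i.e. $\kappa(u)\neq\kappa(v)$ whenever $uv\in E$), where $x_1,x_2,\dots$ are commuting indeterminates. It lies in the ring of symmetric functions over $\mathbb{Q}$, which equals the polynomial ring $\mathbb{Q}[p_1,p_2,\dots]$ in the algebraically independent power sums $p_r=\sum_{i\ge1}x_i^r$. Thus $\partial X_G/\partial p_1$ is defined by regarding $X_G$ as a polynomial in $p_1,p_2,\dots$, and $$\Phi_G=\left.\frac{\partial X_G}{\partial p_1}\right|_{p_1=0}.$$ For $q\ge2$, the uniform leaf extension $C_q(G)$ of $G$ is the graph obtained from $G$ by attaching $q-1$ new leaves (new vertices of degree $1$) to every vertex $v\in V(G)$. *)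

theory Defs
  imports "Graph_Theory.Graph_Theory" "HOL-Library.Poly_Mapping" "HOL-Library.FuncSet"
begin

section \<open>Formal power series in countably many indeterminates\<close>

text \<open>
  Exponent vectors are finitely supported maps \<open>nat \<Rightarrow>\<^sub>0 nat\<close>.  A power series is an arbitrary
  (not necessarily finitely supported) assignment of coefficients to exponent vectors.
\<close>

lemma add_eq_keys:
  fixes a b m :: "'i \<Rightarrow>\<^sub>0 nat"
  assumes "a + b = m"
  shows "Poly_Mapping.keys a \<subseteq> Poly_Mapping.keys m" and "Poly_Mapping.lookup a i \<le> Poly_Mapping.lookup m i"
proof -
  have *: "Poly_Mapping.lookup a i \<le> Poly_Mapping.lookup m i" for i
    by (simp add: lookup_add flip: assms)
  then show "Poly_Mapping.lookup a i \<le> Poly_Mapping.lookup m i" .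
  show "Poly_Mapping.keys a \<subseteq> Poly_Mapping.keys m"
  proof
    fix i assume "i \<in> Poly_Mapping.keys a"
    with *[of i] show "i \<in> Poly_Mapping.keys m" by (simp add: in_keys_iff)
  qed
qed

lemma finite_exponent_splits:
  fixes m :: "'i \<Rightarrow>\<^sub>0 nat"
  shows "finite {(a, b). a + b = m}"
proof -
  let ?A = "{a. \<exists>b. a + b = m}"
  let ?F = "{f. \<forall>i. (i \<in> Poly_Mapping.keys m \<longrightarrow> f i \<in> {..Max (range (Poly_Mapping.lookup m))}) \<and> (i \<notin> Poly_Mapping.keys m \<longrightarrow> f i = (0::nat))}"
  have fr: "finite (range (Poly_Mapping.lookup m))"
  proof -
    have "range (Poly_Mapping.lookup m) \<subseteq> insert 0 (Poly_Mapping.lookup m ` Poly_Mapping.keys m)" by (auto simp: in_keys_iff)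
    then show ?thesis by (rule finite_subset) simp
  qed
  have "finite ?F" by (rule finite_set_of_finite_funs) auto
  moreover have "Poly_Mapping.lookup ` ?A \<subseteq> ?F"
  proof (rule image_subsetI)
    fix a assume "a \<in> ?A"
    then obtain b where ab: "a + b = m" by blast
    have "Poly_Mapping.lookup a i \<le> Max (range (Poly_Mapping.lookup m))" for i
      using add_eq_keys(2)[OF ab, of i] Max_ge[OF fr, of "Poly_Mapping.lookup m i"] by simp
    moreover have "Poly_Mapping.lookup a i = 0" if "i \<notin> Poly_Mapping.keys m" for i
      using add_eq_keys(1)[OF ab] that by (auto simp: in_keys_iff)
    ultimately show "Poly_Mapping.lookup a \<in> ?F" by simp
  qed
  ultimately have "finite (Poly_Mapping.lookup ` ?A)" by (rule rev_finite_subset)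
  then have fA: "finite ?A"
    by (rule finite_imageD) (auto simp: inj_on_def lookup_inject)
  have "{(a, b). a + b = m} \<subseteq> ?A \<times> ?A"
    by (auto simp: add.commute) (metis add.commute)
  then show ?thesis by (rule finite_subset) (simp add: fA)
qed

typedef 'a mps = "UNIV :: ((nat \<Rightarrow>\<^sub>0 nat) \<Rightarrow> 'a) set"
  morphisms mps_coeff Abs_mps ..

setup_lifting type_definition_mps

lemma mps_eqI: "(\<And>m. mps_coeff f m = mps_coeff g m) \<Longrightarrow> f = g"
  by transfer auto

instantiation mps :: (comm_ring_1) comm_ring_1
begin

lift_definition zero_mps :: "'a mps" is "\<lambda>_. 0" .
lift_definition one_mps :: "'a mps" is "\<lambda>m. if m = 0 then 1 else 0" .
lift_definition plus_mps :: "'a mps \<Rightarrow> 'a mps \<Rightarrow> 'a mps" is "\<lambda>f g m. f m + g m" .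
lift_definition minus_mps :: "'a mps \<Rightarrow> 'a mps \<Rightarrow> 'a mps" is "\<lambda>f g m. f m - g m" .
lift_definition uminus_mps :: "'a mps \<Rightarrow> 'a mps" is "\<lambda>f m. - f m" .
lift_definition times_mps :: "'a mps \<Rightarrow> 'a mps \<Rightarrow> 'a mps"
  is "\<lambda>f g m. \<Sum>(a, b)\<in>{(a, b). a + b = m}. f a * g b" .

instance
proof
  fix f g h :: "'a mps"
  show "f + g + h = f + (g + h)" by transfer (simp add: add.assoc)
  show "f + g = g + f" by transfer (simp add: add.commute)
  show "0 + f = f" by transfer simp
  show "- f + f = 0" by transfer simp
  show "f - g = f + - g" by transfer simp
  show "(0::'a mps) \<noteq> 1" by transfer (auto dest: fun_cong[of _ _ 0])
  show "(f + g) * h = f * h + g * h"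
    by transfer (simp add: distrib_right split_def sum.distrib)
  show "f * g = g * f"
  proof (transfer, rule ext)
    fix f g :: "(nat \<Rightarrow>\<^sub>0 nat) \<Rightarrow> 'a" and m
    show "(\<Sum>(a, b)\<in>{(a, b). a + b = m}. f a * g b) = (\<Sum>(a, b)\<in>{(a, b). a + b = m}. g a * f b)"
      by (rule sum.reindex_bij_witness[where i = prod.swap and j = prod.swap])
        (auto simp: add.commute mult.commute)
  qed
  show "1 * f = f"
  proof (transfer, rule ext)
    fix f :: "(nat \<Rightarrow>\<^sub>0 nat) \<Rightarrow> 'a" and m
    have "(\<Sum>(a, b)\<in>{(a, b). a + b = m}. (if a = 0 then 1 else 0) * f b)
        = (\<Sum>(a, b)\<in>{(0 :: nat \<Rightarrow>\<^sub>0 nat, m)}. (if a = 0 then 1 else 0) * f b)"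
      by (rule sum.mono_neutral_right) (auto simp: finite_exponent_splits split: if_splits)
    then show "(\<Sum>(a, b)\<in>{(a, b). a + b = m}. (if a = 0 then 1 else 0) * f b) = f m"
      by simp
  qed
  show "f * g * h = f * (g * h)"
  proof (transfer, rule ext)
    fix f g h :: "(nat \<Rightarrow>\<^sub>0 nat) \<Rightarrow> 'a" and m
    let ?S = "\<lambda>m :: nat \<Rightarrow>\<^sub>0 nat. {(a, b). a + b = m}"
    have "(\<Sum>(x, c)\<in>?S m. (\<Sum>(a, b)\<in>?S x. f a * g b) * h c)
        = (\<Sum>p\<in>?S m. \<Sum>q\<in>?S (fst p). f (fst q) * g (snd q) * h (snd p))"
      by (simp add: sum_distrib_right split_def)
    also have "\<dots> = (\<Sum>(p, q)\<in>Sigma (?S m) (\<lambda>p. ?S (fst p)). f (fst q) * g (snd q) * h (snd p))"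
      by (rule sum.Sigma) (auto simp: finite_exponent_splits split: if_splits)
    also have "\<dots> = (\<Sum>(p, q)\<in>Sigma (?S m) (\<lambda>p. ?S (snd p)). f (fst p) * (g (fst q) * h (snd q)))"
      by (rule sum.reindex_bij_witness
          [where i = "\<lambda>(p, q). ((fst p + fst q, snd q), (fst p, fst q))"
             and j = "\<lambda>(p, q). ((fst q, snd q + snd p), (snd q, snd p))"])
        (auto simp: add.assoc mult.assoc)
    also have "\<dots> = (\<Sum>p\<in>?S m. \<Sum>q\<in>?S (snd p). f (fst p) * (g (fst q) * h (snd q)))"
      by (rule sum.Sigma[symmetric]) (auto simp: finite_exponent_splits split: if_splits)
    also have "\<dots> = (\<Sum>(a, x)\<in>?S m. f a * (\<Sum>(b, c)\<in>?S x. g b * h c))"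
      by (simp add: sum_distrib_left split_def)
    finally show "(\<Sum>(x, c)\<in>?S m. (\<Sum>(a, b)\<in>?S x. f a * g b) * h c)
        = (\<Sum>(a, x)\<in>?S m. f a * (\<Sum>(b, c)\<in>?S x. g b * h c))" .
  qed
qed

end

lift_definition mps_const :: "'a::zero \<Rightarrow> 'a mps" is "\<lambda>c m. if m = 0 then c else 0" .


section \<open>Polynomials in the power sums\<close>

text \<open>
  The indeterminates are \<open>x\<^sub>1, x\<^sub>2, \<dots>\<close>; the index 0 of the type \<open>nat\<close> is never used.
  The definition of the power sum is only meaningful for \<open>r \<ge> 1\<close>.
\<close>

lift_definition power_sum :: "nat \<Rightarrow> rat mps"
  is "\<lambda>r m. if \<exists>i\<ge>1. m = Poly_Mapping.single i r then 1 else 0" .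

text \<open>
  An element of \<open>\<rat>[p\<^sub>1, p\<^sub>2, \<dots>]\<close> is a finitely supported map from exponent vectors to \<open>\<rat>\<close>,
  where index \<open>r\<close> stands for the indeterminate \<open>p\<^sub>r\<close> and index 0 must not occur.
\<close>

type_synonym p_poly = "(nat \<Rightarrow>\<^sub>0 nat) \<Rightarrow>\<^sub>0 rat"

definition p_polys :: "p_poly set" where
  "p_polys = {P. \<forall>m\<in>Poly_Mapping.keys P. 0 \<notin> Poly_Mapping.keys m}"

definition p_eval :: "p_poly \<Rightarrow> rat mps" where
  "p_eval P = (\<Sum>m\<in>Poly_Mapping.keys P. mps_const (Poly_Mapping.lookup P m) * (\<Prod>r\<in>Poly_Mapping.keys m. power_sum r ^ Poly_Mapping.lookup m r))"

text \<open>
  The polynomial in the power sums representing a symmetric function; it is unique because the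
  power sums are algebraically independent.
\<close>

definition p_expansion :: "rat mps \<Rightarrow> p_poly" where
  "p_expansion F = (THE P. P \<in> p_polys \<and> p_eval P = F)"

definition p_deriv :: "nat \<Rightarrow> p_poly \<Rightarrow> p_poly" where
  "p_deriv r P = (\<Sum>m\<in>Poly_Mapping.keys P.
     Poly_Mapping.single (m - Poly_Mapping.single r 1) (of_nat (Poly_Mapping.lookup m r) * Poly_Mapping.lookup P m))"

definition p_set_zero :: "nat \<Rightarrow> p_poly \<Rightarrow> p_poly" where
  "p_set_zero r P = (\<Sum>m\<in>{m\<in>Poly_Mapping.keys P. r \<notin> Poly_Mapping.keys m}. Poly_Mapping.single m (Poly_Mapping.lookup P m))"


section \<open>Graphs and their chromatic symmetric functions\<close>

text \<open>
  Finite simple undirected graphs are values satisfying \<^const>\<open>pair_graph\<close>: an edge \<open>uv\<close> is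
  represented by the two arcs \<open>(u, v)\<close> and \<open>(v, u)\<close>.
\<close>

definition proper_colorings :: "'v pair_pre_digraph \<Rightarrow> ('v \<Rightarrow> nat) set" where
  "proper_colorings G =
     {\<kappa> \<in> pverts G \<rightarrow>\<^sub>E {1..}. \<forall>(u, v)\<in>parcs G. \<kappa> u \<noteq> \<kappa> v}"

definition coloring_monomial :: "'v pair_pre_digraph \<Rightarrow> ('v \<Rightarrow> nat) \<Rightarrow> (nat \<Rightarrow>\<^sub>0 nat)" where
  "coloring_monomial G \<kappa> = (\<Sum>v\<in>pverts G. Poly_Mapping.single (\<kappa> v) 1)"

text \<open>
  The sum over all proper colorings is infinite, but each monomial arises from only finitely many
  colorings; the coefficient of a monomial is the number of these.
\<close>

lift_definition chromatic_symmetric_function :: "'v pair_pre_digraph \<Rightarrow> rat mps"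
  is "\<lambda>G m. of_nat (card {\<kappa> \<in> proper_colorings G. coloring_monomial G \<kappa> = m})" .

lemma finite_colorings_of_monomial:
  assumes "finite (pverts G)"
  shows "finite {\<kappa> \<in> proper_colorings G. coloring_monomial G \<kappa> = m}"
proof (rule finite_subset)
  show "{\<kappa> \<in> proper_colorings G. coloring_monomial G \<kappa> = m} \<subseteq> pverts G \<rightarrow>\<^sub>E Poly_Mapping.keys m"
  proof
    fix \<kappa> assume "\<kappa> \<in> {\<kappa> \<in> proper_colorings G. coloring_monomial G \<kappa> = m}"
    then have \<kappa>: "\<kappa> \<in> proper_colorings G" and m: "coloring_monomial G \<kappa> = m" by auto
    have "\<kappa> v \<in> Poly_Mapping.keys (coloring_monomial G \<kappa>)" if v: "v \<in> pverts G" for v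
    proof -
      have "Poly_Mapping.lookup (coloring_monomial G \<kappa>) (\<kappa> v)
          = (\<Sum>u\<in>pverts G. if \<kappa> u = \<kappa> v then Suc 0 else 0)"
        by (simp add: coloring_monomial_def lookup_sum lookup_single when_def)
      also have "\<dots> \<noteq> 0" using assms v by auto
      finally show ?thesis by (simp add: in_keys_iff)
    qed
    then show "\<kappa> \<in> pverts G \<rightarrow>\<^sub>E Poly_Mapping.keys m"
      using \<kappa> m by (auto simp: proper_colorings_def PiE_iff)
  qed
  show "finite (pverts G \<rightarrow>\<^sub>E Poly_Mapping.keys m)" using assms by (simp add: finite_PiE)
qed

definition Phi :: "'v pair_pre_digraph \<Rightarrow> p_poly" where
  "Phi G = p_set_zero 1 (p_deriv 1 (p_expansion (chromatic_symmetric_function G)))"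

text \<open>
  The vertex \<open>v\<close> of \<open>G\<close> becomes \<open>(v, 0)\<close>, and the leaves attached to it are
  \<open>(v, 1), \<dots>, (v, q - 1)\<close>.
\<close>

definition leaf_extension :: "nat \<Rightarrow> 'v pair_pre_digraph \<Rightarrow> ('v \<times> nat) pair_pre_digraph" where
  "leaf_extension q G = \<lparr>
     pverts = pverts G \<times> {0..<q},
     parcs = {((u, 0), (v, 0)) | u v. (u, v) \<in> parcs G}
       \<union> {((v, 0), (v, i)) | v i. v \<in> pverts G \<and> i \<in> {1..<q}}
       \<union> {((v, i), (v, 0)) | v i. v \<in> pverts G \<and> i \<in> {1..<q}}\<rparr>"

lemma pair_graph_leaf_extension:
  assumes "pair_graph G" and "q \<ge> 1"
  shows "pair_graph (leaf_extension q G)"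
proof -
  interpret pair_graph G by fact
  have fin: "finite (pverts (leaf_extension q G))"
    using pair_finite_verts by (simp add: leaf_extension_def)
  have wf: "fst e \<in> pverts (leaf_extension q G) \<and> snd e \<in> pverts (leaf_extension q G)"
    if "e \<in> parcs (leaf_extension q G)" for e
    using that assms(2) by (auto simp: leaf_extension_def in_arcsD1 in_arcsD2)
  have "parcs (leaf_extension q G)
      \<subseteq> pverts (leaf_extension q G) \<times> pverts (leaf_extension q G)"
    using wf by (auto simp: mem_Times_iff)
  then have fin': "finite (parcs (leaf_extension q G))"
    by (rule finite_subset) (simp add: fin)
  have "sym (parcs (leaf_extension q G))"
    by (rule symI) (auto simp: leaf_extension_def intro: arcs_symmetric)
  then have sy: "symmetric (with_proj (leaf_extension q G))"
    by (simp add: symmetric_def)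
  have lf: "fst e \<noteq> snd e" if "e \<in> parcs (leaf_extension q G)" for e
    using that by (auto simp: leaf_extension_def dest: no_loops')
  show ?thesis
    using wf fin fin' sy lf by unfold_locales auto
qed

end

theory Submission
  imports Defs
begin

text \<open>
  Stanley's expansion \<open>X\<^sub>G = \<Sum>\<^sub>S (-1)\<^bsup>|S|\<^esup> p\<^bsub>\<lambda>(S)\<^esub>\<close> sums over the sets \<open>S\<close> of edges, \<open>\<lambda>(S)\<close> being the partition
  of the component sizes.  A term is linear in \<open>p\<^sub>1\<close> if \<open>S\<close> leaves exactly one vertex isolated, and \<open>\<Phi>\<^sub>G\<close>
  collects these terms with the factor \<open>p\<^sub>1\<close> removed.  In \<open>C\<^sub>q(G)\<close> every leaf whose edge is not
  chosen is isolated, and if all leaf edges are chosen then no vertex is isolated.  So exactly one leaf edge,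
  at some vertex \<open>v\<close>, is missing.  The component of \<open>v\<close> in \<open>S \<inter> E(G)\<close>, of size \<open>k\<close>, then grows to \<open>qk - 1\<close>,
  and every other component grows by the factor \<open>q\<close>.  Hence, with \<open>n\<close> the number of vertices of \<open>G\<close>,
  \<open>\<Phi>\<^bsub>C\<^sub>q(G)\<^esub> = (-1)\<^bsup>n(q-1)-1\<^esup> (q-1) \<Sum>\<^sub>k k p\<^bsub>qk-1\<^esub> (\<partial>X\<^sub>G/\<partial>p\<^sub>k)(p\<^sub>j := p\<^bsub>qj\<^esub>)\<close>,
  where the summand with \<open>qk - 1 = 1\<close> is dropped (lemma \<open>Phi_leaf_extension\<close>).

  As \<open>q \<ge> 2\<close>, the index \<open>qk - 1\<close> is not a multiple of \<open>q\<close>, while all other indices are.  The summands therefore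
  do not interfere, and each coefficient of \<open>X\<^sub>G\<close> in the power sums can be read off from \<open>\<Phi>\<^bsub>C\<^sub>q(G)\<^esub>\<close>,
  except for that of \<open>p\<^sub>1\<^sup>n\<close> when \<open>q = 2\<close>; but this one is always 1
  (lemmas \<open>leaf_operator_determines\<close>, \<open>lookup_chromatic_p_poly_isolated\<close>).  The scalar in front depends
  on \<open>n\<close>, which is found from the degree \<open>qn - 1\<close> of \<open>\<Phi>\<^bsub>C\<^sub>q(G)\<^esub>\<close> unless this is 0.  It is 0 only if
  \<open>q = 2\<close> and \<open>G\<close> is a single vertex; this is where connectedness enters
  (lemma \<open>chromatic_p_poly_if_leaf_operator_0\<close>).

  All this takes place in the polynomial ring in the power sums.  That it says something about \<open>X\<^sub>G\<close> as a power
  series, and that \<open>\<Phi>\<^sub>G\<close> is well defined, rests on the algebraic independence of the power sums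
  (lemma \<open>p_eval_eq_0_imp\<close>).
\<close>

section \<open>Polynomials in the power sums and their values\<close>

text \<open>
  The constants \<^const>\<open>p_eval\<close>, \<^const>\<open>p_deriv\<close> and \<^const>\<open>p_set_zero\<close> are all sums over the
  monomials of a polynomial of something additive in the coefficient.  Such a sum can be read off
  any presentation of the polynomial as a sum of terms, even one in which monomials repeat and
  cancel.  Expansions over edge subsets are of that kind.
\<close>

lemma sum_keys_of_sum_single:
  fixes h :: "'k \<Rightarrow> 'b::comm_monoid_add \<Rightarrow> 'c::comm_monoid_add"
  assumes "\<And>k. h k 0 = 0" and "\<And>k x y. h k (x + y) = h k x + h k y" and "finite I"
    and "P = (\<Sum>i\<in>I. Poly_Mapping.single (m i) (c i))"
  shows "(\<Sum>k\<in>Poly_Mapping.keys P. h k (Poly_Mapping.lookup P k)) = (\<Sum>i\<in>I. h (m i) (c i))"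
  using assms(3) unfolding assms(4)
proof (induction I)
  case (insert x I)
  have "(\<Sum>k\<in>Poly_Mapping.keys (Poly_Mapping.single (m x) (c x)).
      h k (Poly_Mapping.lookup (Poly_Mapping.single (m x) (c x)) k)) = h (m x) (c x)"
    using assms(1) by (cases "c x = 0") auto
  then show ?case using insert
    by (simp add: setsum_keys_plus_distrib[of h] assms)
qed auto

lemma mps_coeff_simps [simp]:
  "mps_coeff (0 :: 'a::comm_ring_1 mps) a = 0"
  "mps_coeff (f + g) a = mps_coeff f a + mps_coeff g a"
  "mps_coeff (f - g) a = mps_coeff f a - mps_coeff g a"
  by (transfer; simp)+

lemma mps_coeff_sum: "mps_coeff (sum f A) a = (\<Sum>x\<in>A. mps_coeff (f x) a)"
  by (induction A rule: infinite_finite_induct) auto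

lemma mps_coeff_mult:
  "mps_coeff (f * g) a = (\<Sum>(b, c)\<in>{(b, c). b + c = a}. mps_coeff f b * mps_coeff g c)"
  by (simp only: times_mps.rep_eq)

lemma mps_coeff_const_mult: "mps_coeff (mps_const c * f) a = c * mps_coeff f a"
proof -
  have "mps_coeff (mps_const c * f) a
      = (\<Sum>(b, d)\<in>{(b, d). b + d = a}. mps_coeff (mps_const c) b * mps_coeff f d)"
    by (rule mps_coeff_mult)
  also have "\<dots> = (\<Sum>(b, d)\<in>{(0, a)}. mps_coeff (mps_const c) b * mps_coeff f d)"
    by (rule sum.mono_neutral_right)
      (auto simp: finite_exponent_splits mps_const.rep_eq split: if_splits)
  finally show ?thesis by (simp add: mps_const.rep_eq)
qed

definition p_monomial :: "(nat \<Rightarrow>\<^sub>0 nat) \<Rightarrow> rat mps" where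
  "p_monomial m = (\<Prod>r\<in>Poly_Mapping.keys m. power_sum r ^ Poly_Mapping.lookup m r)"

lemma p_monomial_superset:
  assumes "finite A" and "Poly_Mapping.keys m \<subseteq> A"
  shows "p_monomial m = (\<Prod>r\<in>A. power_sum r ^ Poly_Mapping.lookup m r)"
  unfolding p_monomial_def
  by (rule prod.mono_neutral_left) (use assms in \<open>auto simp: in_keys_iff\<close>)

lemma p_monomial_add: "p_monomial (m + m') = p_monomial m * p_monomial m'"
proof -
  let ?A = "Poly_Mapping.keys m \<union> Poly_Mapping.keys m'"
  have "p_monomial (m + m') = (\<Prod>r\<in>?A. power_sum r ^ Poly_Mapping.lookup (m + m') r)"
    by (rule p_monomial_superset) (use keys_add[of m m'] in auto)
  also have "\<dots> = p_monomial m * p_monomial m'"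
    by (simp add: p_monomial_superset[of ?A] lookup_add power_add prod.distrib)
  finally show ?thesis .
qed

lemma p_monomial_sum:
  "finite J \<Longrightarrow> p_monomial (\<Sum>j\<in>J. Poly_Mapping.single (r j) 1) = (\<Prod>j\<in>J. power_sum (r j))"
proof (induction J rule: finite_induct)
  case (insert x J)
  have "p_monomial (Poly_Mapping.single (r x) 1) = power_sum (r x)"
    by (simp add: p_monomial_def)
  with insert show ?case by (simp add: p_monomial_add)
qed (simp add: p_monomial_def)

lemma p_eval_sum_single:
  assumes "finite I"
  shows "p_eval (\<Sum>i\<in>I. Poly_Mapping.single (m i) (c i))
    = (\<Sum>i\<in>I. mps_const (c i) * p_monomial (m i))"
proof -
  have "mps_const (x + y) = mps_const x + mps_const y" for x y :: rat
    by transfer auto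
  moreover have "mps_const (0 :: rat) = 0" by transfer auto
  ultimately show ?thesis
    unfolding p_eval_def p_monomial_def[symmetric]
    by (intro sum_keys_of_sum_single[where h = "\<lambda>m c. mps_const c * p_monomial m"])
      (simp_all add: distrib_right assms)
qed

lemma mps_coeff_p_eval:
  "mps_coeff (p_eval P) a
    = (\<Sum>m\<in>Poly_Mapping.keys P. Poly_Mapping.lookup P m * mps_coeff (p_monomial m) a)"
  unfolding p_eval_def p_monomial_def[symmetric] by (simp add: mps_coeff_sum mps_coeff_const_mult)

lemma p_eval_add: "p_eval (P + Q) = p_eval P + p_eval Q"
proof (rule mps_eqI)
  fix a
  show "mps_coeff (p_eval (P + Q)) a = mps_coeff (p_eval P + p_eval Q) a"
    using setsum_keys_plus_distrib[of "\<lambda>m c. c * mps_coeff (p_monomial m) a" P Q]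
    by (simp add: mps_coeff_p_eval distrib_right)
qed

text \<open>
  Expanding the product means choosing one variable \<open>x\<^bsub>f j\<^esub>\<close> for every factor \<open>j\<close>.  Exponents must be
  positive: otherwise different choices of a variable would yield the same monomial, and the choices
  would not be counted by the product.
\<close>

lemma mps_coeff_prod_power_sum:
  assumes "finite J" and "\<And>j. j \<in> J \<Longrightarrow> r j \<ge> 1"
  shows "finite {f \<in> J \<rightarrow>\<^sub>E {1..}. (\<Sum>j\<in>J. Poly_Mapping.single (f j) (r j)) = a} \<and>
    mps_coeff (\<Prod>j\<in>J. power_sum (r j)) a
    = of_nat (card {f \<in> J \<rightarrow>\<^sub>E {1..}. (\<Sum>j\<in>J. Poly_Mapping.single (f j) (r j)) = a})"
  using assms
proof (induction J arbitrary: a rule: finite_induct)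
  case empty
  have "mps_coeff (1 :: rat mps) a = (if a = 0 then 1 else 0)" by transfer simp
  then show ?case by simp
next
  case (insert x J)
  define N where "N J a = {f \<in> J \<rightarrow>\<^sub>E {1..}. (\<Sum>j\<in>J. Poly_Mapping.single (f j) (r j)) = a}"
    for J and a :: "nat \<Rightarrow>\<^sub>0 nat"
  have IH: "finite (N J a)" "mps_coeff (\<Prod>j\<in>J. power_sum (r j)) a = of_nat (card (N J a))" for a
    using insert.IH insert.prems unfolding N_def by auto
  \<comment> \<open>The choices in which the new factor contributes \<open>b\<close> and the factors in \<open>J\<close> contribute \<open>c\<close>.\<close>
  define M where "M = (\<lambda>(b, c). {f \<in> N (insert x J) a.
    Poly_Mapping.single (f x) (r x) = b \<and> (\<Sum>j\<in>J. Poly_Mapping.single (f j) (r j)) = c})"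
  have M: "finite (M (b, c)) \<and> (of_nat (card (M (b, c))) :: rat)
      = mps_coeff (power_sum (r x)) b * mps_coeff (\<Prod>j\<in>J. power_sum (r j)) c" if "b + c = a" for b c
  proof (cases "\<exists>i\<ge>1. b = Poly_Mapping.single i (r x)")
    case False
    have "M (b, c) = {}"
    proof (rule ccontr)
      assume "M (b, c) \<noteq> {}"
      then obtain f where "f \<in> M (b, c)" by blast
      then have "f x \<ge> 1" "b = Poly_Mapping.single (f x) (r x)"
        by (auto simp: M_def N_def PiE_iff)
      with False show False by blast
    qed
    then show ?thesis using False by (auto simp: power_sum.rep_eq)
  next
    case True
    then obtain i where i: "i \<ge> 1" "b = Poly_Mapping.single i (r x)" by blast
    have uniq: "k = i" if "Poly_Mapping.single k (r x) = b" for k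
    proof -
      have "Poly_Mapping.keys (Poly_Mapping.single k (r x)) = Poly_Mapping.keys b"
        using that by simp
      then show ?thesis using i insert.prems[of x] by simp
    qed
    have [simp]: "(\<Sum>j\<in>J. Poly_Mapping.single (if j = x then i else g j) (r j))
        = (\<Sum>j\<in>J. Poly_Mapping.single (g j) (r j))" for g
      by (rule sum.cong) (use insert.hyps in auto)
    have "bij_betw (\<lambda>g. g(x := i)) (N J c) (M (b, c))"
    proof (rule bij_betw_byWitness[where f' = "\<lambda>f. restrict f J"])
      show "\<forall>g\<in>N J c. restrict (g(x := i)) J = g"
      proof
        fix g assume "g \<in> N J c"
        then have "g \<in> extensional J" by (auto simp: N_def PiE_iff)
        then show "restrict (g(x := i)) J = g"
          using insert.hyps by (auto simp: fun_eq_iff extensional_def restrict_def)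
      qed
      show "\<forall>f\<in>M (b, c). (restrict f J)(x := i) = f"
      proof
        fix f assume f: "f \<in> M (b, c)"
        then have "f \<in> extensional (insert x J)" "f x = i"
          using uniq by (auto simp: M_def N_def PiE_iff)
        then show "(restrict f J)(x := i) = f"
          by (auto simp: fun_eq_iff extensional_def restrict_def)
      qed
      show "(\<lambda>g. g(x := i)) ` N J c \<subseteq> M (b, c)"
        using i that insert.hyps by (auto simp: M_def N_def PiE_iff extensional_def)
      show "(\<lambda>f. restrict f J) ` M (b, c) \<subseteq> N J c"
        by (auto simp: M_def N_def PiE_iff extensional_def cong: sum.cong)
    qed
    then have "card (M (b, c)) = card (N J c)" "finite (M (b, c))"
      using IH(1) by (auto dest: bij_betw_same_card bij_betw_finite)
    moreover have "mps_coeff (power_sum (r x)) b = 1"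
      using i by (auto simp: power_sum.rep_eq)
    ultimately show ?thesis by (simp add: IH)
  qed
  have U: "N (insert x J) a = (\<Union>p\<in>{(b, c). b + c = a}. M p)"
    using insert.hyps by (auto simp: M_def N_def)
  have fin: "\<forall>p\<in>{(b, c). b + c = a}. finite (M p)"
    using M by auto
  have "card (N (insert x J) a) = (\<Sum>p\<in>{(b, c). b + c = a}. card (M p))"
    unfolding U by (rule card_UN_disjoint) (use fin in \<open>auto simp: finite_exponent_splits M_def\<close>)
  then have "of_nat (card (N (insert x J) a))
      = (\<Sum>p\<in>{(b, c). b + c = a}. (of_nat (card (M p)) :: rat))"
    by simp
  also have "\<dots> = (\<Sum>(b, c)\<in>{(b, c). b + c = a}.
      mps_coeff (power_sum (r x)) b * mps_coeff (\<Prod>j\<in>J. power_sum (r j)) c)"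
    by (rule sum.cong) (use M in auto)
  also have "\<dots> = mps_coeff (\<Prod>j\<in>insert x J. power_sum (r j)) a"
    using insert.hyps by (simp add: mps_coeff_mult)
  finally have "mps_coeff (\<Prod>j\<in>insert x J. power_sum (r j)) a = of_nat (card (N (insert x J) a))" ..
  moreover have "finite (N (insert x J) a)"
    unfolding U using fin finite_exponent_splits by blast
  ultimately show ?case unfolding N_def by blast
qed

section \<open>Algebraic independence of the power sums\<close>

text \<open>
  The parts of the partition encoded by \<open>m\<close> (in which \<open>r\<close> occurs \<open>m(r)\<close> times), made distinguishable
  by a running number, so that the product of power sums can be indexed by a set.
\<close>

definition part_slots :: "(nat \<Rightarrow>\<^sub>0 nat) \<Rightarrow> (nat \<times> nat) set" where
  "part_slots m = (SIGMA r:Poly_Mapping.keys m. {..<Poly_Mapping.lookup m r})"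

lemma finite_part_slots [simp]: "finite (part_slots m)"
  by (simp add: part_slots_def)

lemma sum_single_part_slots: "(\<Sum>j\<in>part_slots m. Poly_Mapping.single (fst j) 1) = m"
proof (rule poly_mapping_eqI)
  fix r
  have "Poly_Mapping.lookup (\<Sum>j\<in>part_slots m. Poly_Mapping.single (fst j) 1) r
      = (\<Sum>j\<in>part_slots m. if fst j = r then 1 else 0)"
    by (simp add: lookup_sum lookup_single when_def)
  also have "\<dots> = card {j \<in> part_slots m. fst j = r}"
    by (simp add: sum.If_cases Int_def)
  also have "{j \<in> part_slots m. fst j = r} = {r} \<times> {..<Poly_Mapping.lookup m r}"
    by (auto simp: part_slots_def in_keys_iff)
  finally show "Poly_Mapping.lookup (\<Sum>j\<in>part_slots m. Poly_Mapping.single (fst j) 1) r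
      = Poly_Mapping.lookup m r"
    by (simp add: card_cartesian_product)
qed

lemma keys_sum_single:
  assumes "finite J" and "\<And>j. j \<in> J \<Longrightarrow> r j \<ge> (1::nat)"
  shows "Poly_Mapping.keys (\<Sum>j\<in>J. Poly_Mapping.single (f j) (r j)) = f ` J"
proof -
  have "Poly_Mapping.lookup (\<Sum>j\<in>J. Poly_Mapping.single (f j) (r j)) i
      = (\<Sum>j\<in>J. if f j = i then r j else 0)" for i
    by (simp add: lookup_sum lookup_single when_def)
  then show ?thesis using assms
    by (force simp: in_keys_iff set_eq_iff split: if_splits)
qed

lemma sum_single_lookup:
  assumes "finite J" and "\<And>j. j \<in> J \<Longrightarrow> r j \<ge> (1::nat)" and "inj_on f J"
    and "a = (\<Sum>j\<in>J. Poly_Mapping.single (f j) (r j))"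
  shows "(\<Sum>i\<in>Poly_Mapping.keys a. Poly_Mapping.single (Poly_Mapping.lookup a i) (1::nat))
    = (\<Sum>j\<in>J. Poly_Mapping.single (r j) 1)"
proof -
  have "Poly_Mapping.lookup a (f j) = r j" if "j \<in> J" for j
  proof -
    have "Poly_Mapping.lookup a (f j) = (\<Sum>k\<in>J. if f k = f j then r k else 0)"
      by (simp add: assms(4) lookup_sum lookup_single when_def)
    also have "\<dots> = (\<Sum>k\<in>J. if k = j then r k else 0)"
      by (rule sum.cong) (use assms(3) that in \<open>auto simp: inj_on_def\<close>)
    finally show ?thesis using that assms(1) by simp
  qed
  then show ?thesis
    using assms(3) by (simp add: assms(4) keys_sum_single[OF assms(1,2)] sum.reindex)
qed

text \<open>
  Here \<open>a\<close> is the exponent vector that assigns the parts of \<open>m\<close> to pairwise different variables.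
  A product of power sums contains \<open>x\<^sup>a\<close> only if \<open>a\<close> arises by merging its parts, so it needs at least as
  many parts as \<open>m\<close>; with equally many, nothing is merged and the parts are those of \<open>m\<close>.  This is the
  triangularity between power sums and monomial symmetric functions.
\<close>

lemma p_monomial_coeff_nonzero_unique:
  assumes "0 \<notin> Poly_Mapping.keys m" and "0 \<notin> Poly_Mapping.keys m'"
    and "inj_on g (part_slots m)"
    and "a = (\<Sum>j\<in>part_slots m. Poly_Mapping.single (g j) (fst j))"
    and "card (part_slots m') \<le> card (part_slots m)"
    and "mps_coeff (p_monomial m') a \<noteq> 0"
  shows "m' = m"
proof -
  have pos: "fst j \<ge> 1" if "j \<in> part_slots m \<union> part_slots m'" for j
    using that assms(1,2) by (cases "fst j") (auto simp: part_slots_def)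
  have "p_monomial m' = (\<Prod>j\<in>part_slots m'. power_sum (fst j))"
    using p_monomial_sum[of "part_slots m'" fst] by (simp add: sum_single_part_slots del: One_nat_def)
  then have "mps_coeff (p_monomial m') a = of_nat (card {f \<in> part_slots m' \<rightarrow>\<^sub>E {1..}.
      (\<Sum>j\<in>part_slots m'. Poly_Mapping.single (f j) (fst j)) = a})"
    using mps_coeff_prod_power_sum[of "part_slots m'" fst a] pos by simp
  with assms(6) have "{f \<in> part_slots m' \<rightarrow>\<^sub>E {1..}.
      (\<Sum>j\<in>part_slots m'. Poly_Mapping.single (f j) (fst j)) = a} \<noteq> {}"
    by (metis (lifting) card.empty of_nat_0)
  then obtain f where f: "a = (\<Sum>j\<in>part_slots m'. Poly_Mapping.single (f j) (fst j))"
    by blast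
  have "Poly_Mapping.keys a = f ` part_slots m'"
    unfolding f by (rule keys_sum_single) (use pos in auto)
  moreover have "Poly_Mapping.keys a = g ` part_slots m"
    unfolding assms(4) by (rule keys_sum_single) (use pos in auto)
  ultimately have "f ` part_slots m' = g ` part_slots m" by simp
  then have "card (f ` part_slots m') \<ge> card (part_slots m')"
    using assms(3,5) by (simp add: card_image)
  then have "inj_on f (part_slots m')"
    by (intro eq_card_imp_inj_on antisym card_image_le) auto
  then have "(\<Sum>i\<in>Poly_Mapping.keys a. Poly_Mapping.single (Poly_Mapping.lookup a i) 1) = m'"
    using sum_single_lookup[OF _ _ _ f] pos by (simp only: sum_single_part_slots) simp
  moreover have "(\<Sum>i\<in>Poly_Mapping.keys a. Poly_Mapping.single (Poly_Mapping.lookup a i) 1) = m"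
    using sum_single_lookup[OF _ _ assms(3,4)] pos by (simp only: sum_single_part_slots) simp
  ultimately show ?thesis by simp
qed

lemma p_monomial_coeff_nonzero:
  assumes "0 \<notin> Poly_Mapping.keys m" and "g \<in> part_slots m \<rightarrow>\<^sub>E {1..}"
  shows "mps_coeff (p_monomial m) (\<Sum>j\<in>part_slots m. Poly_Mapping.single (g j) (fst j)) \<noteq> 0"
proof -
  let ?a = "\<Sum>j\<in>part_slots m. Poly_Mapping.single (g j) (fst j)"
  let ?N = "{f \<in> part_slots m \<rightarrow>\<^sub>E {1..}. (\<Sum>j\<in>part_slots m. Poly_Mapping.single (f j) (fst j)) = ?a}"
  have pos: "fst j \<ge> 1" if "j \<in> part_slots m" for j
    using that assms(1) by (cases "fst j") (auto simp: part_slots_def)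
  have "p_monomial m = (\<Prod>j\<in>part_slots m. power_sum (fst j))"
    using p_monomial_sum[of "part_slots m" fst] by (simp add: sum_single_part_slots del: One_nat_def)
  moreover have "g \<in> ?N" using assms(2) by simp
  ultimately show ?thesis
    using mps_coeff_prod_power_sum[of "part_slots m" fst ?a] pos by auto
qed

text \<open>
  Algebraic independence of the power sums: by triangularity, a monomial of \<open>P\<close> with the largest
  number of parts has a witness \<open>x\<^sup>a\<close> to which no other monomial of \<open>P\<close> contributes.
\<close>

lemma p_eval_eq_0_imp:
  assumes "P \<in> p_polys" and "p_eval P = 0"
  shows "P = 0"
proof (rule ccontr)
  assume "P \<noteq> 0"
  then have "Poly_Mapping.keys P \<noteq> {}" by simp
  define l where "l = Max ((\<lambda>m. card (part_slots m)) ` Poly_Mapping.keys P)"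
  have "l \<in> (\<lambda>m. card (part_slots m)) ` Poly_Mapping.keys P"
    unfolding l_def using \<open>Poly_Mapping.keys P \<noteq> {}\<close> by (intro Max_in) auto
  then obtain m where m: "m \<in> Poly_Mapping.keys P" "card (part_slots m) = l" by auto
  have max: "card (part_slots m') \<le> card (part_slots m)" if "m' \<in> Poly_Mapping.keys P" for m'
    unfolding m(2) l_def using that by (intro Max_ge) auto
  \<comment> \<open>Distinct variables for the parts, shifted by one because variables are numbered from 1.\<close>
  obtain h :: "nat \<times> nat \<Rightarrow> nat" where h: "inj_on h (part_slots m)"
    using finite_imp_inj_to_nat_seg[of "part_slots m"] by auto
  define g where "g = restrict (\<lambda>j. Suc (h j)) (part_slots m)"
  have g: "inj_on g (part_slots m)" "g \<in> part_slots m \<rightarrow>\<^sub>E {1..}"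
    using h by (auto simp: g_def inj_on_def)
  define a where "a = (\<Sum>j\<in>part_slots m. Poly_Mapping.single (g j) (fst j))"
  have z: "0 \<notin> Poly_Mapping.keys m'" if "m' \<in> Poly_Mapping.keys P" for m'
    using assms(1) that by (auto simp: p_polys_def)
  have "0 = mps_coeff (p_eval P) a" using assms(2) by simp
  also have "\<dots> = (\<Sum>m'\<in>Poly_Mapping.keys P. Poly_Mapping.lookup P m' * mps_coeff (p_monomial m') a)"
    by (rule mps_coeff_p_eval)
  also have "\<dots> = (\<Sum>m'\<in>{m}. Poly_Mapping.lookup P m' * mps_coeff (p_monomial m') a)"
    using p_monomial_coeff_nonzero_unique[OF z z g(1) a_def max] m(1)
    by (intro sum.mono_neutral_right) auto
  also have "\<dots> \<noteq> 0"
    using p_monomial_coeff_nonzero[OF z[OF m(1)] g(2)] m(1) by (simp add: a_def in_keys_iff)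
  finally show False by simp
qed

text \<open>
  Independence makes the definite description in \<^const>\<open>p_expansion\<close> meaningful; from here on it
  suffices to exhibit some polynomial with the right value.
\<close>

lemma p_expansion_p_eval:
  assumes "P \<in> p_polys"
  shows "p_expansion (p_eval P) = P"
  unfolding p_expansion_def
proof (rule the_equality)
  fix Q assume Q: "Q \<in> p_polys \<and> p_eval Q = p_eval P"
  have "p_eval (Q - P) + p_eval P = p_eval Q"
    by (simp flip: p_eval_add)
  then have "p_eval (Q - P) = 0" using Q by simp
  moreover have "Q - P \<in> p_polys"
    unfolding p_polys_def
  proof safe
    fix m assume "m \<in> Poly_Mapping.keys (Q - P)" "0 \<in> Poly_Mapping.keys m"
    moreover from this have "m \<in> Poly_Mapping.keys Q \<union> Poly_Mapping.keys P"
      by (auto simp: in_keys_iff lookup_minus)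
    ultimately show False using Q assms by (auto simp: p_polys_def)
  qed
  ultimately show "Q = P" using p_eval_eq_0_imp by fastforce
qed (simp add: assms)

section \<open>The power-sum expansion of the chromatic symmetric function\<close>

definition constant_on_fibres :: "'v set \<Rightarrow> ('v \<Rightarrow> 'j) \<Rightarrow> ('v \<Rightarrow> 'c) \<Rightarrow> bool" where
  "constant_on_fibres V \<pi> \<kappa> \<longleftrightarrow> (\<forall>u\<in>V. \<forall>v\<in>V. \<pi> u = \<pi> v \<longrightarrow> \<kappa> u = \<kappa> v)"

text \<open>
  The set partition of \<open>V\<close> into the fibres of \<open>\<pi>\<close> determines the integer partition of its block sizes,
  here as the exponent vector of a monomial in the power sums.  Describing set partitions by maps
  avoids reasoning about connected components as sets.
\<close>

definition fibre_type :: "'v set \<Rightarrow> ('v \<Rightarrow> 'j) \<Rightarrow> (nat \<Rightarrow>\<^sub>0 nat)" where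
  "fibre_type V \<pi> = (\<Sum>j\<in>\<pi> ` V. Poly_Mapping.single (card {v\<in>V. \<pi> v = j}) 1)"

lemma card_fibre_pos:
  assumes "finite V" and "j \<in> \<pi> ` V"
  shows "card {v\<in>V. \<pi> v = j} \<ge> 1"
proof -
  have "card {v\<in>V. \<pi> v = j} \<noteq> 0" using assms by auto
  then show ?thesis by simp
qed

lemma keys_fibre_type: "finite V \<Longrightarrow> Poly_Mapping.keys (fibre_type V \<pi>) = (\<lambda>j. card {v\<in>V. \<pi> v = j}) ` \<pi> ` V"
  unfolding fibre_type_def by (rule keys_sum_single) auto

lemma fibre_type_inj:
  assumes "finite V" and "inj_on \<pi> V"
  shows "fibre_type V \<pi> = Poly_Mapping.single 1 (card V)"
proof -
  have "card {v\<in>V. \<pi> v = j} = 1" if "j \<in> \<pi> ` V" for j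
  proof -
    from that obtain v where "v \<in> V" "j = \<pi> v" by blast
    then have "{u\<in>V. \<pi> u = j} = {v}" using assms(2) by (auto dest: inj_onD)
    then show ?thesis by simp
  qed
  then have "fibre_type V \<pi> = (\<Sum>j\<in>\<pi> ` V. Poly_Mapping.single 1 1)"
    unfolding fibre_type_def by (intro sum.cong) auto
  also have "\<dots> = of_nat (card V) * Poly_Mapping.single 1 1"
    using assms by (simp add: card_image)
  also have "\<dots> = Poly_Mapping.single 1 (card V)"
    by (simp add: mult_single del: single_of_nat flip: single_of_nat)
  finally show ?thesis .
qed

text \<open>
  A vertex is chosen by choosing a block size, then one of the blocks of that size, then a point in
  it.  This turns the choice of a vertex that misses a leaf into the operator \<open>\<Sum>\<^sub>k k p\<^bsub>qk-1\<^esub> \<partial>/\<partial>p\<^sub>k\<close>.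
\<close>

lemma sum_card_fibre:
  fixes g :: "nat \<Rightarrow> 'c::comm_semiring_1"
  assumes "finite V"
  shows "(\<Sum>v\<in>V. g (card {u\<in>V. \<pi> u = \<pi> v}))
    = (\<Sum>k\<in>Poly_Mapping.keys (fibre_type V \<pi>). of_nat (k * Poly_Mapping.lookup (fibre_type V \<pi>) k) * g k)"
proof -
  let ?f = "\<lambda>j. card {u\<in>V. \<pi> u = j}"
  have "(\<Sum>v\<in>V. g (?f (\<pi> v))) = (\<Sum>j\<in>\<pi> ` V. \<Sum>v\<in>{v\<in>V. \<pi> v = j}. g (?f (\<pi> v)))"
    by (rule sum.image_gen) fact
  also have "\<dots> = (\<Sum>j\<in>\<pi> ` V. of_nat (?f j * 1) * g (?f j))"
    by (rule sum.cong) auto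
  also have "\<dots> = (\<Sum>k\<in>Poly_Mapping.keys (fibre_type V \<pi>). of_nat (k * Poly_Mapping.lookup (fibre_type V \<pi>) k) * g k)"
    by (rule sum_keys_of_sum_single[where h = "\<lambda>k x. of_nat (k * x) * g k", symmetric])
      (use assms in \<open>auto simp: fibre_type_def distrib_left distrib_right\<close>)
  finally show ?thesis .
qed

text \<open>
  A coloring that is constant on every fibre picks one variable per fibre, with the size of the fibre
  as its exponent.  Hence the generating function of these colorings is the product of the power sums
  of the fibre sizes.
\<close>

lemma mps_coeff_p_monomial_fibre_type:
  fixes \<pi> :: "'v \<Rightarrow> 'j"
  assumes "finite V"
  defines "K \<equiv> \<lambda>a. {\<kappa> \<in> V \<rightarrow>\<^sub>E {1..}. constant_on_fibres V \<pi> \<kappa> \<and> (\<Sum>v\<in>V. Poly_Mapping.single (\<kappa> v) 1) = a}"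
  shows "finite (K a)" and "mps_coeff (p_monomial (fibre_type V \<pi>)) a = of_nat (card (K a))"
proof -
  define r where "r j = card {v\<in>V. \<pi> v = j}" for j
  define N where "N = {f \<in> \<pi> ` V \<rightarrow>\<^sub>E {1..}. (\<Sum>j\<in>\<pi> ` V. Poly_Mapping.single (f j) (r j)) = a}"
  have r: "r j \<ge> 1" if "j \<in> \<pi> ` V" for j
    using card_fibre_pos[OF assms(1) that] by (simp add: r_def)
  have weight: "(\<Sum>v\<in>V. Poly_Mapping.single (f (\<pi> v)) 1) = (\<Sum>j\<in>\<pi> ` V. Poly_Mapping.single (f j) (r j))"
    for f :: "'j \<Rightarrow> nat"
  proof -
    have "(\<Sum>v\<in>V. Poly_Mapping.single (f (\<pi> v)) 1)
        = (\<Sum>j\<in>\<pi> ` V. \<Sum>v\<in>{v\<in>V. \<pi> v = j}. Poly_Mapping.single (f (\<pi> v)) 1)"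
      by (rule sum.image_gen) fact
    also have "\<dots> = (\<Sum>j\<in>\<pi> ` V. of_nat (r j) * Poly_Mapping.single (f j) 1)"
      by (rule sum.cong) (auto simp: r_def)
    also have "\<dots> = (\<Sum>j\<in>\<pi> ` V. Poly_Mapping.single (f j) (r j))"
      by (rule sum.cong) (simp_all add: mult_single del: single_of_nat flip: single_of_nat)
    finally show ?thesis .
  qed
  have inv: "inv_into V \<pi> j \<in> V" "\<pi> (inv_into V \<pi> j) = j" if "j \<in> \<pi> ` V" for j
    using that by (auto intro: inv_into_into f_inv_into_f)
  have "bij_betw (\<lambda>f. restrict (\<lambda>v. f (\<pi> v)) V) N (K a)"
  proof (rule bij_betw_byWitness[where f' = "\<lambda>\<kappa>. restrict (\<lambda>j. \<kappa> (inv_into V \<pi> j)) (\<pi> ` V)"])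
    show "\<forall>f\<in>N. restrict (\<lambda>j. restrict (\<lambda>v. f (\<pi> v)) V (inv_into V \<pi> j)) (\<pi> ` V) = f"
    proof
      fix f assume "f \<in> N"
      then have "f \<in> extensional (\<pi> ` V)" by (auto simp: N_def PiE_iff)
      then show "restrict (\<lambda>j. restrict (\<lambda>v. f (\<pi> v)) V (inv_into V \<pi> j)) (\<pi> ` V) = f"
        by (intro extensionalityI[of _ "\<pi> ` V"]) (use inv in auto)
    qed
    show "\<forall>\<kappa>\<in>K a. restrict (\<lambda>v. restrict (\<lambda>j. \<kappa> (inv_into V \<pi> j)) (\<pi> ` V) (\<pi> v)) V = \<kappa>"
    proof
      fix \<kappa> assume \<kappa>: "\<kappa> \<in> K a"
      then have "\<kappa> \<in> extensional V" by (auto simp: K_def PiE_iff)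
      moreover have "\<kappa> (inv_into V \<pi> (\<pi> v)) = \<kappa> v" if "v \<in> V" for v
        using \<kappa> inv[of "\<pi> v"] that unfolding K_def constant_on_fibres_def by blast
      ultimately show "restrict (\<lambda>v. restrict (\<lambda>j. \<kappa> (inv_into V \<pi> j)) (\<pi> ` V) (\<pi> v)) V = \<kappa>"
        by (intro extensionalityI[of _ V]) auto
    qed
    show "(\<lambda>f. restrict (\<lambda>v. f (\<pi> v)) V) ` N \<subseteq> K a"
    proof (rule image_subsetI)
      fix f assume f: "f \<in> N"
      have "(\<Sum>v\<in>V. Poly_Mapping.single (restrict (\<lambda>v. f (\<pi> v)) V v) 1)
          = (\<Sum>v\<in>V. Poly_Mapping.single (f (\<pi> v)) 1)"
        by (rule sum.cong) auto
      also have "\<dots> = a" using f weight[of f] by (simp add: N_def)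
      finally show "restrict (\<lambda>v. f (\<pi> v)) V \<in> K a"
        using f by (auto simp: K_def N_def constant_on_fibres_def PiE_iff)
    qed
    show "(\<lambda>\<kappa>. restrict (\<lambda>j. \<kappa> (inv_into V \<pi> j)) (\<pi> ` V)) ` K a \<subseteq> N"
    proof (rule image_subsetI)
      fix \<kappa> assume \<kappa>: "\<kappa> \<in> K a"
      let ?f = "restrict (\<lambda>j. \<kappa> (inv_into V \<pi> j)) (\<pi> ` V)"
      have "\<kappa> (inv_into V \<pi> (\<pi> v)) = \<kappa> v" if "v \<in> V" for v
        using \<kappa> inv[of "\<pi> v"] that unfolding K_def constant_on_fibres_def by blast
      then have "(\<Sum>v\<in>V. Poly_Mapping.single (?f (\<pi> v)) 1) = (\<Sum>v\<in>V. Poly_Mapping.single (\<kappa> v) 1)"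
        by (intro sum.cong) auto
      also have "\<dots> = a" using \<kappa> by (simp add: K_def)
      finally have "(\<Sum>j\<in>\<pi> ` V. Poly_Mapping.single (?f j) (r j)) = a"
        by (simp only: weight)
      moreover have "\<forall>v\<in>V. \<kappa> v \<ge> 1" using \<kappa> by (auto simp: K_def PiE_iff)
      then have "?f \<in> \<pi> ` V \<rightarrow>\<^sub>E {1..}"
        using inv by (auto simp: PiE_iff)
      ultimately show "?f \<in> N" by (simp add: N_def)
    qed
  qed
  moreover have "finite N \<and> mps_coeff (\<Prod>j\<in>\<pi> ` V. power_sum (r j)) a = of_nat (card N)"
    unfolding N_def by (rule mps_coeff_prod_power_sum) (use assms(1) r in auto)
  moreover have "p_monomial (fibre_type V \<pi>) = (\<Prod>j\<in>\<pi> ` V. power_sum (r j))"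
    unfolding fibre_type_def r_def by (rule p_monomial_sum) (simp add: assms(1))
  ultimately show "finite (K a)" and "mps_coeff (p_monomial (fibre_type V \<pi>)) a = of_nat (card (K a))"
    by (auto dest: bij_betw_same_card bij_betw_finite)
qed

lemma indicator_inclusion_exclusion:
  assumes "finite A"
  shows "(if \<forall>x\<in>A. \<not> B x then 1 else 0 :: rat)
    = (\<Sum>S\<in>Pow A. (-1) ^ card S * (if \<forall>x\<in>S. B x then 1 else 0))"
proof -
  have prod_ind: "(\<Prod>x\<in>S. if C x then 1 else 0 :: rat) = (if \<forall>x\<in>S. C x then 1 else 0)"
    if "finite S" for S C
    using that by (induction S rule: finite_induct) auto
  have "(if \<forall>x\<in>A. \<not> B x then 1 else 0 :: rat) = (\<Prod>x\<in>A. if \<not> B x then 1 else 0)"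
    using assms by (simp only: prod_ind)
  also have "\<dots> = (\<Prod>x\<in>A. 1 - (if B x then 1 else 0))"
    by (rule prod.cong) auto
  also have "\<dots> = (\<Sum>S\<in>Pow A. (-1) ^ card S * (\<Prod>x\<in>S. if B x then 1 else 0))"
    by (simp add: prod_diff_conv_sum[OF assms])
  also have "\<dots> = (\<Sum>S\<in>Pow A. (-1) ^ card S * (if \<forall>x\<in>S. B x then 1 else 0))"
    using assms by (intro sum.cong) (auto simp: prod_ind finite_subset)
  finally show ?thesis .
qed

text \<open>
  Writing the indicator function of proper colorings as a combination of indicator functions for
  constancy on fibres is all that is needed to expand the chromatic symmetric function in power sums.
  The same principle serves for a graph and for its leaf extension.
\<close>

lemma p_expansion_chromatic_symmetric_function:
  fixes \<pi> :: "'i \<Rightarrow> 'v \<Rightarrow> 'j" and G :: "'v pair_pre_digraph"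
  assumes "finite (pverts G)" and "finite I"
    and "\<And>\<kappa>. \<kappa> \<in> pverts G \<rightarrow>\<^sub>E {1..} \<Longrightarrow> (if \<kappa> \<in> proper_colorings G then 1 else 0 :: rat)
      = (\<Sum>i\<in>I. c i * (if constant_on_fibres (pverts G) (\<pi> i) \<kappa> then 1 else 0))"
    and "P = (\<Sum>i\<in>I. Poly_Mapping.single (fibre_type (pverts G) (\<pi> i)) (c i))"
  shows "P \<in> p_polys" and "chromatic_symmetric_function G = p_eval P"
    and "p_expansion (chromatic_symmetric_function G) = P"
proof -
  let ?V = "pverts G"
  show P: "P \<in> p_polys"
    unfolding p_polys_def
  proof safe
    fix m assume m: "m \<in> Poly_Mapping.keys P" and 0: "0 \<in> Poly_Mapping.keys m"
    have "Poly_Mapping.keys P \<subseteq> (\<Union>i\<in>I. Poly_Mapping.keys (Poly_Mapping.single (fibre_type ?V (\<pi> i)) (c i)))"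
      unfolding assms(4) by (rule keys_sum)
    with m obtain i where "m = fibre_type ?V (\<pi> i)" by (auto split: if_splits)
    with 0 have "0 \<in> (\<lambda>j. card {v\<in>?V. \<pi> i v = j}) ` \<pi> i ` ?V"
      by (simp only: keys_fibre_type[OF assms(1)])
    then obtain j where "j \<in> \<pi> i ` ?V" "card {v\<in>?V. \<pi> i v = j} = 0" by (metis (no_types, lifting) imageE)
    then show False using card_fibre_pos[OF assms(1), of j "\<pi> i"] by simp
  qed
  show X: "chromatic_symmetric_function G = p_eval P"
  proof (rule mps_eqI)
    fix a :: "nat \<Rightarrow>\<^sub>0 nat"
    define K where "K = {\<kappa> \<in> ?V \<rightarrow>\<^sub>E {1..}. (\<Sum>v\<in>?V. Poly_Mapping.single (\<kappa> v) 1) = a}"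
    have "finite K"
      using mps_coeff_p_monomial_fibre_type(1)[OF assms(1), of id a]
      by (simp add: K_def constant_on_fibres_def)
    have "{\<kappa> \<in> proper_colorings G. coloring_monomial G \<kappa> = a} = {\<kappa> \<in> K. \<kappa> \<in> proper_colorings G}"
      by (auto simp: K_def proper_colorings_def coloring_monomial_def)
    then have "mps_coeff (chromatic_symmetric_function G) a
        = (\<Sum>\<kappa>\<in>K. if \<kappa> \<in> proper_colorings G then 1 else 0)"
      using \<open>finite K\<close> by (simp add: chromatic_symmetric_function.rep_eq sum.If_cases Int_def)
    also have "\<dots> = (\<Sum>\<kappa>\<in>K. \<Sum>i\<in>I. c i * (if constant_on_fibres ?V (\<pi> i) \<kappa> then 1 else 0))"
      by (rule sum.cong) (use assms(3) in \<open>auto simp: K_def\<close>)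
    also have "\<dots> = (\<Sum>i\<in>I. \<Sum>\<kappa>\<in>K. c i * (if constant_on_fibres ?V (\<pi> i) \<kappa> then 1 else 0))"
      by (rule sum.swap)
    also have "\<dots> = (\<Sum>i\<in>I. c i * of_nat (card {\<kappa>\<in>K. constant_on_fibres ?V (\<pi> i) \<kappa>}))"
      using \<open>finite K\<close> by (simp add: sum_distrib_left[symmetric] sum.If_cases Int_def)
    also have "\<dots> = (\<Sum>i\<in>I. c i * mps_coeff (p_monomial (fibre_type ?V (\<pi> i))) a)"
    proof (rule sum.cong)
      fix i
      have "{\<kappa>\<in>K. constant_on_fibres ?V (\<pi> i) \<kappa>} = {\<kappa> \<in> ?V \<rightarrow>\<^sub>E {1..}. constant_on_fibres ?V (\<pi> i) \<kappa>
          \<and> (\<Sum>v\<in>?V. Poly_Mapping.single (\<kappa> v) 1) = a}"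
        by (auto simp: K_def)
      then show "c i * of_nat (card {\<kappa>\<in>K. constant_on_fibres ?V (\<pi> i) \<kappa>})
          = c i * mps_coeff (p_monomial (fibre_type ?V (\<pi> i))) a"
        by (simp only: mps_coeff_p_monomial_fibre_type(2)[OF assms(1)])
    qed simp
    also have "\<dots> = mps_coeff (p_eval P) a"
      by (simp add: assms(4) p_eval_sum_single[OF assms(2)] mps_coeff_sum mps_coeff_const_mult)
    finally show "mps_coeff (chromatic_symmetric_function G) a = mps_coeff (p_eval P) a" .
  qed
  show "p_expansion (chromatic_symmetric_function G) = P"
    unfolding X using P by (rule p_expansion_p_eval)
qed

text \<open>
  The connected component of \<open>v\<close> in the spanning subgraph with edge set \<open>S\<close>.  Orientations of the
  arcs in \<open>S\<close> do not matter, hence the converse.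
\<close>

definition reach_class :: "('v \<times> 'v) set \<Rightarrow> 'v \<Rightarrow> 'v set" where
  "reach_class S v = {u. (v, u) \<in> (S \<union> S\<inverse>)\<^sup>*}"

lemma reach_class_eq_iff: "reach_class S u = reach_class S v \<longleftrightarrow> (u, v) \<in> (S \<union> S\<inverse>)\<^sup>*"
proof
  assume "reach_class S u = reach_class S v"
  then show "(u, v) \<in> (S \<union> S\<inverse>)\<^sup>*" by (auto simp: reach_class_def)
next
  assume *: "(u, v) \<in> (S \<union> S\<inverse>)\<^sup>*"
  have "sym ((S \<union> S\<inverse>)\<^sup>*)" by (rule sym_rtrancl) (rule sym_Un_converse)
  with * have "(v, u) \<in> (S \<union> S\<inverse>)\<^sup>*" by (auto dest: symD)
  with * show "reach_class S u = reach_class S v"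
    by (auto simp: reach_class_def intro: rtrancl_trans)
qed

lemma constant_on_reach_class_iff:
  assumes "S \<subseteq> V \<times> V"
  shows "constant_on_fibres V (reach_class S) \<kappa> \<longleftrightarrow> (\<forall>(u, v)\<in>S. \<kappa> u = \<kappa> v)"
proof
  assume "constant_on_fibres V (reach_class S) \<kappa>"
  then show "\<forall>(u, v)\<in>S. \<kappa> u = \<kappa> v"
    using assms by (auto simp: constant_on_fibres_def reach_class_eq_iff)
next
  assume *: "\<forall>(u, v)\<in>S. \<kappa> u = \<kappa> v"
  have "\<kappa> u = \<kappa> v" if "(u, v) \<in> (S \<union> S\<inverse>)\<^sup>*" for u v
    using that by (induction rule: rtrancl_induct) (use * in auto)
  then show "constant_on_fibres V (reach_class S) \<kappa>"
    by (auto simp: constant_on_fibres_def reach_class_eq_iff)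
qed

text \<open>
  Stanley's expansion \<open>\<Sum>\<^sub>S (-1)\<^bsup>|S|\<^esup> p\<^bsub>\<lambda>(S)\<^esub>\<close>, taken over subsets of arcs instead of edges.  An edge then
  contributes the condition of being monochromatic twice, once for each direction; inclusion-exclusion
  is insensitive to such a repetition, and no orientation has to be chosen.
\<close>

definition chromatic_p_poly :: "'v pair_pre_digraph \<Rightarrow> p_poly" where
  "chromatic_p_poly G = (\<Sum>S\<in>Pow (parcs G).
     Poly_Mapping.single (fibre_type (pverts G) (reach_class S)) ((-1) ^ card S))"

lemma arcs_subset:
  assumes "pair_graph G"
  shows "parcs G \<subseteq> pverts G \<times> pverts G" "finite (pverts G)" "finite (parcs G)"
proof -
  interpret pair_graph G by fact
  show "parcs G \<subseteq> pverts G \<times> pverts G"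
    by (auto dest: in_arcsD1 in_arcsD2)
  show "finite (pverts G)" "finite (parcs G)" by auto
qed

lemma chromatic_p_poly_represents:
  assumes "pair_graph G"
  shows "chromatic_p_poly G \<in> p_polys" and "chromatic_symmetric_function G = p_eval (chromatic_p_poly G)"
proof -
  note ar = arcs_subset[OF assms]
  have "(if \<kappa> \<in> proper_colorings G then 1 else 0 :: rat)
      = (\<Sum>S\<in>Pow (parcs G). (-1) ^ card S * (if constant_on_fibres (pverts G) (reach_class S) \<kappa> then 1 else 0))"
    if "\<kappa> \<in> pverts G \<rightarrow>\<^sub>E {1..}" for \<kappa>
  proof -
    have "(if \<kappa> \<in> proper_colorings G then 1 else 0 :: rat)
        = (if \<forall>e\<in>parcs G. \<not> \<kappa> (fst e) = \<kappa> (snd e) then 1 else 0)"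
      using that by (simp add: proper_colorings_def split_def)
    also have "\<dots> = (\<Sum>S\<in>Pow (parcs G). (-1) ^ card S * (if \<forall>e\<in>S. \<kappa> (fst e) = \<kappa> (snd e) then 1 else 0))"
      by (rule indicator_inclusion_exclusion) (rule ar)
    also have "\<dots> = (\<Sum>S\<in>Pow (parcs G). (-1) ^ card S * (if constant_on_fibres (pverts G) (reach_class S) \<kappa> then 1 else 0))"
    proof (rule sum.cong)
      fix S assume "S \<in> Pow (parcs G)"
      then have "S \<subseteq> pverts G \<times> pverts G" using ar by auto
      then show "(-1) ^ card S * (if \<forall>e\<in>S. \<kappa> (fst e) = \<kappa> (snd e) then 1 else 0)
          = (-1 :: rat) ^ card S * (if constant_on_fibres (pverts G) (reach_class S) \<kappa> then 1 else 0)"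
        by (simp add: constant_on_reach_class_iff split_def)
    qed simp
    finally show ?thesis .
  qed
  note * = p_expansion_chromatic_symmetric_function[OF ar(2) _ this chromatic_p_poly_def]
  show "chromatic_p_poly G \<in> p_polys" "chromatic_symmetric_function G = p_eval (chromatic_p_poly G)"
    using *(1,2) ar(3) by simp_all
qed

text \<open>
  Only the empty arc set leaves all vertices isolated, since there are no loops.  This coefficient of
  \<open>p\<^sub>1\<^sup>n\<close> supplies the one piece of information that is lost when \<open>q = 2\<close>, and it shows that the
  polynomial is not zero.
\<close>

lemma lookup_chromatic_p_poly_isolated:
  assumes "pair_graph G"
  shows "Poly_Mapping.lookup (chromatic_p_poly G) (Poly_Mapping.single 1 (card (pverts G))) = 1"
proof -
  interpret pair_graph G by fact
  let ?V = "pverts G"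
  have iff: "fibre_type ?V (reach_class S) = Poly_Mapping.single 1 (card ?V) \<longleftrightarrow> S = {}"
    if S: "S \<subseteq> parcs G" for S
  proof
    assume ft: "fibre_type ?V (reach_class S) = Poly_Mapping.single 1 (card ?V)"
    show "S = {}"
    proof (rule ccontr)
      assume "S \<noteq> {}"
      then obtain u v where uv: "(u, v) \<in> S" by auto
      then have V: "u \<in> ?V" "v \<in> ?V" "u \<noteq> v"
        using S by (auto dest: in_arcsD1 in_arcsD2 no_loops')
      let ?F = "{w\<in>?V. reach_class S w = reach_class S u}"
      have "v \<in> ?F" using uv V reach_class_eq_iff[of S v u] by auto
      then have "{u, v} \<subseteq> ?F" using V by auto
      then have "card {u, v} \<le> card ?F" by (intro card_mono) auto
      then have "card ?F \<noteq> 1" using V by auto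
      moreover have "card ?F \<in> Poly_Mapping.keys (fibre_type ?V (reach_class S))"
        using V by (auto simp: keys_fibre_type)
      ultimately show False unfolding ft by (auto split: if_splits)
    qed
  next
    assume "S = {}"
    then show "fibre_type ?V (reach_class S) = Poly_Mapping.single 1 (card ?V)"
      by (intro fibre_type_inj) (auto simp: inj_on_def reach_class_eq_iff)
  qed
  have "Poly_Mapping.lookup (chromatic_p_poly G) (Poly_Mapping.single 1 (card ?V))
      = (\<Sum>S\<in>Pow (parcs G). if S = {} then (-1) ^ card S else 0)"
    unfolding chromatic_p_poly_def lookup_sum lookup_single when_def
    by (rule sum.cong) (use iff in auto)
  then show ?thesis by simp
qed

text \<open>
  If the chromatic symmetric function is \<open>p\<^sub>1\<^sup>n\<close>, there are as many proper colorings with a given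
  monomial as colorings, so the coloring with a single color is proper.
\<close>

lemma edgeless_if_chromatic_p_poly_trivial:
  assumes "pair_graph G"
    and "chromatic_p_poly G = Poly_Mapping.single (Poly_Mapping.single 1 (card (pverts G))) 1"
  shows "parcs G = {}"
proof -
  interpret pair_graph G by fact
  let ?V = "pverts G"
  let ?a = "Poly_Mapping.single 1 (card ?V) :: nat \<Rightarrow>\<^sub>0 nat"
  define K where "K = {\<kappa> \<in> ?V \<rightarrow>\<^sub>E {1..}. constant_on_fibres ?V id \<kappa> \<and> (\<Sum>v\<in>?V. Poly_Mapping.single (\<kappa> v) 1) = ?a}"
  define X where "X = {\<kappa> \<in> proper_colorings G. coloring_monomial G \<kappa> = ?a}"
  have K: "finite K" "mps_coeff (p_monomial (fibre_type ?V id)) ?a = of_nat (card K)"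
    unfolding K_def by (rule mps_coeff_p_monomial_fibre_type; simp)+
  have "chromatic_symmetric_function G = p_monomial (fibre_type ?V id)"
  proof (rule mps_eqI)
    fix b show "mps_coeff (chromatic_symmetric_function G) b = mps_coeff (p_monomial (fibre_type ?V id)) b"
      unfolding chromatic_p_poly_represents(2)[OF assms(1)] mps_coeff_p_eval assms(2)
      by (simp add: fibre_type_inj)
  qed
  then have "mps_coeff (chromatic_symmetric_function G) ?a = of_nat (card K)"
    using K(2) by simp
  moreover have "mps_coeff (chromatic_symmetric_function G) ?a = of_nat (card X)"
    by (simp add: X_def chromatic_symmetric_function.rep_eq)
  ultimately have "of_nat (card X) = (of_nat (card K) :: rat)" by simp
  then have "card X = card K" by simp
  moreover have "X \<subseteq> K"
    by (auto simp: X_def K_def proper_colorings_def coloring_monomial_def constant_on_fibres_def)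
  ultimately have "X = K" using K(1) by (intro card_subset_eq) auto
  let ?one = "restrict (\<lambda>_. 1 :: nat) ?V"
  have "card {w\<in>?V. id w = v} = 1" if "v \<in> ?V" for v
  proof -
    from that have "{w\<in>?V. id w = v} = {v}" by auto
    then show ?thesis by simp
  qed
  then have "(\<Sum>v\<in>?V. Poly_Mapping.single (?one v) 1) = fibre_type ?V id"
    unfolding fibre_type_def by (intro sum.cong) simp_all
  then have "?one \<in> K"
    by (auto simp: K_def constant_on_fibres_def fibre_type_inj)
  then have "?one \<in> X" using \<open>X = K\<close> by simp
  then have proper: "\<forall>(u, v)\<in>parcs G. ?one u \<noteq> ?one v" by (simp add: X_def proper_colorings_def)
  show "parcs G = {}"
  proof (rule ccontr)
    assume "parcs G \<noteq> {}"
    then obtain u v where "(u, v) \<in> parcs G" by auto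
    moreover from this have "u \<in> ?V" "v \<in> ?V" using arcs_subset(1)[OF assms(1)] by auto
    ultimately show False using proper by fastforce
  qed
qed

lemma connected_card_pos:
  assumes "pair_graph G" and "Digraph_Component.connected (with_proj G)"
  shows "card (pverts G) \<ge> 1"
proof -
  have "pverts G \<noteq> {}"
    using assms(2) by (auto simp: Digraph_Component.connected_def strongly_connected_def mk_symmetric_def)
  then show ?thesis using arcs_subset(2)[OF assms(1)] by (simp add: Suc_le_eq card_gt_0_iff)
qed

lemma connected_edgeless:
  assumes "Digraph_Component.connected (with_proj G)" and "parcs G = {}"
  shows "card (pverts G) = 1"
proof -
  let ?M = "mk_symmetric (with_proj G)"
  have M: "pverts ?M = pverts G" "parcs ?M = {}"
    using assms(2) by (auto simp: mk_symmetric_def)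
  have "pverts G \<noteq> {}" "\<forall>u\<in>pverts G. \<forall>v\<in>pverts G. u \<rightarrow>\<^sup>*\<^bsub>with_proj ?M\<^esub> v"
    using assms(1) M by (auto simp: Digraph_Component.connected_def strongly_connected_def)
  moreover have "u = v" if "u \<rightarrow>\<^sup>*\<^bsub>with_proj ?M\<^esub> v" for u v
    using that M by (auto simp: reachable_def arcs_ends_def elim: rtrancl_on.cases)
  ultimately obtain u where "pverts G = {u}" by blast
  then show ?thesis by simp
qed

section \<open>The operator induced by attaching leaves\<close>

definition scale_parts :: "nat \<Rightarrow> (nat \<Rightarrow>\<^sub>0 nat) \<Rightarrow> (nat \<Rightarrow>\<^sub>0 nat)" where
  "scale_parts q m = (\<Sum>k\<in>Poly_Mapping.keys m. Poly_Mapping.single (q * k) (Poly_Mapping.lookup m k))"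

lemma scale_parts_sum_single:
  assumes "finite I"
  shows "scale_parts q (\<Sum>i\<in>I. Poly_Mapping.single (f i) (c i)) = (\<Sum>i\<in>I. Poly_Mapping.single (q * f i) (c i))"
  unfolding scale_parts_def
  by (rule sum_keys_of_sum_single[where h = "\<lambda>k c. Poly_Mapping.single (q * k) c"])
    (use assms in \<open>auto simp: single_add\<close>)

lemma lookup_scale_parts:
  assumes "q \<ge> 1"
  shows "Poly_Mapping.lookup (scale_parts q m) (q * k) = Poly_Mapping.lookup m k"
    and "\<not> q dvd i \<Longrightarrow> Poly_Mapping.lookup (scale_parts q m) i = 0"
proof -
  have "Poly_Mapping.lookup (scale_parts q m) (q * k)
      = (\<Sum>j\<in>Poly_Mapping.keys m. if j = k then Poly_Mapping.lookup m j else 0)"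
    unfolding scale_parts_def lookup_sum lookup_single when_def
    by (rule sum.cong) (use assms in auto)
  then show "Poly_Mapping.lookup (scale_parts q m) (q * k) = Poly_Mapping.lookup m k"
    by (simp add: in_keys_iff)
  show "Poly_Mapping.lookup (scale_parts q m) i = 0" if "\<not> q dvd i"
    unfolding scale_parts_def lookup_sum lookup_single when_def
    by (rule sum.neutral) (use that in auto)
qed

text \<open>
  Attaching all leaves but one multiplies every block size by \<open>q\<close>, except that the block at the missing
  leaf, of size \<open>k\<close>, gets size \<open>qk - 1\<close>.
\<close>

definition leaf_type :: "nat \<Rightarrow> (nat \<Rightarrow>\<^sub>0 nat) \<Rightarrow> nat \<Rightarrow> (nat \<Rightarrow>\<^sub>0 nat)" where
  "leaf_type q m k = Poly_Mapping.single (q * k - 1) 1 + scale_parts q (m - Poly_Mapping.single k 1)"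

lemma split_off_part:
  fixes m :: "nat \<Rightarrow>\<^sub>0 nat"
  assumes "k \<in> Poly_Mapping.keys m"
  shows "m = Poly_Mapping.single k 1 + (m - Poly_Mapping.single k 1)"
  using assms by (intro poly_mapping_eqI) (auto simp: lookup_add lookup_minus lookup_single when_def in_keys_iff)

text \<open>
  The part \<open>qk - 1\<close> is the only part that is not a multiple of \<open>q\<close>.  It reveals \<open>k\<close>, and the other parts
  divided by \<open>q\<close> are the rest of \<open>m\<close>.
\<close>

lemma leaf_type_inj:
  assumes "q \<ge> 2" "k \<ge> 1" "k' \<ge> 1" "k \<in> Poly_Mapping.keys m" "k' \<in> Poly_Mapping.keys m'"
    and eq: "leaf_type q m k = leaf_type q m' k'"
  shows "k = k'" and "m = m'"
proof -
  have nd: "\<not> q dvd q * k - 1"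
  proof
    assume "q dvd q * k - 1"
    then have "q dvd q * k - (q * k - 1)" by (rule dvd_diff_nat[rotated]) simp
    moreover have "q * k - (q * k - 1) = 1" using assms by (cases "q * k") auto
    ultimately show False using assms(1) by simp
  qed
  have "Poly_Mapping.lookup (leaf_type q m k) (q * k - 1) = 1"
    using lookup_scale_parts(2)[OF _ nd] assms(1) by (simp add: leaf_type_def lookup_add)
  then have "Poly_Mapping.lookup (leaf_type q m' k') (q * k - 1) = 1" by (simp add: eq)
  then have "Poly_Mapping.lookup (Poly_Mapping.single (q * k' - 1) (1::nat)) (q * k - 1) = 1"
    using lookup_scale_parts(2)[OF _ nd] assms(1) by (simp add: leaf_type_def lookup_add)
  then have "q * k' - 1 = q * k - 1" by (auto simp: lookup_single when_def split: if_splits)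
  moreover have "q * k \<ge> 1" "q * k' \<ge> 1" using assms by auto
  ultimately have "q * k = q * k'" by linarith
  then show "k = k'" using assms(1) by simp
  then have sc: "scale_parts q (m - Poly_Mapping.single k 1) = scale_parts q (m' - Poly_Mapping.single k 1)"
    using eq by (simp add: leaf_type_def)
  have "m - Poly_Mapping.single k 1 = m' - Poly_Mapping.single k 1"
  proof (rule poly_mapping_eqI)
    fix j
    have q1: "q \<ge> 1" using assms(1) by simp
    show "Poly_Mapping.lookup (m - Poly_Mapping.single k 1) j = Poly_Mapping.lookup (m' - Poly_Mapping.single k 1) j"
      using arg_cong[OF sc, of "\<lambda>x. Poly_Mapping.lookup x (q * j)"] by (simp only: lookup_scale_parts(1)[OF q1])
  qed
  then show "m = m'" using split_off_part[OF assms(4)] split_off_part[OF assms(5)] \<open>k = k'\<close> by simp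
qed

text \<open>
  The degree in the variables \<open>x\<^sub>i\<close>, where \<open>p\<^sub>k\<close> has degree \<open>k\<close>.
\<close>

definition weight :: "(nat \<Rightarrow>\<^sub>0 nat) \<Rightarrow> nat" where
  "weight m = (\<Sum>k\<in>Poly_Mapping.keys m. k * Poly_Mapping.lookup m k)"

lemma weight_add: "weight (m + m') = weight m + weight m'"
  unfolding weight_def by (rule setsum_keys_plus_distrib) (auto simp: distrib_left)

lemma weight_single [simp]: "weight (Poly_Mapping.single k c) = k * c"
  by (simp add: weight_def)

lemma weight_scale_parts: "weight (scale_parts q m) = q * weight m"
proof -
  have "weight (scale_parts q m) = (\<Sum>k\<in>Poly_Mapping.keys m. (q * k) * Poly_Mapping.lookup m k)"
    unfolding weight_def
    by (rule sum_keys_of_sum_single[where h = "\<lambda>k c. k * c"]) (auto simp: distrib_left scale_parts_def)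
  then show ?thesis by (simp add: weight_def sum_distrib_left mult.assoc)
qed

lemma weight_leaf_type:
  assumes "q \<ge> 1" and "k \<ge> 1" and "k \<in> Poly_Mapping.keys m"
  shows "weight (leaf_type q m k) + 1 = q * weight m"
proof -
  have "weight m = k + weight (m - Poly_Mapping.single k 1)"
    by (subst split_off_part[OF assms(3)]) (simp add: weight_add)
  moreover have "q * k \<ge> 1" using assms by auto
  ultimately show ?thesis
    by (simp add: leaf_type_def weight_add weight_scale_parts distrib_left)
qed

lemma weight_fibre_type: "finite V \<Longrightarrow> weight (fibre_type V \<pi>) = card V"
  using sum_card_fibre[of V "\<lambda>_. 1 :: nat" \<pi>] by (simp add: weight_def)

text \<open>
  The operator \<open>P \<mapsto> \<Sum>\<^sub>k k p\<^bsub>qk-1\<^esub> (\<partial>P/\<partial>p\<^sub>k)(p\<^sub>j := p\<^bsub>qj\<^esub>)\<close>, first on the term \<open>c p\<^sup>m\<close> and then on polynomials.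
  The equation \<open>qk = 2\<close> means \<open>q = 2\<close> and \<open>k = 1\<close>: that summand has the factor \<open>p\<^bsub>qk-1\<^esub> = p\<^sub>1\<close>
  and dies when \<open>p\<^sub>1\<close> is set to 0.
\<close>

definition leaf_monomial :: "nat \<Rightarrow> (nat \<Rightarrow>\<^sub>0 nat) \<Rightarrow> rat \<Rightarrow> p_poly" where
  "leaf_monomial q m c = (\<Sum>k\<in>Poly_Mapping.keys m. of_nat (k * Poly_Mapping.lookup m k) *
     (if q * k \<noteq> 2 then Poly_Mapping.single (leaf_type q m k) c else 0))"

definition leaf_operator :: "nat \<Rightarrow> p_poly \<Rightarrow> p_poly" where
  "leaf_operator q P = (\<Sum>m\<in>Poly_Mapping.keys P. leaf_monomial q m (Poly_Mapping.lookup P m))"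

lemma leaf_operator_sum_single:
  assumes "finite I"
  shows "leaf_operator q (\<Sum>i\<in>I. Poly_Mapping.single (m i) (c i)) = (\<Sum>i\<in>I. leaf_monomial q (m i) (c i))"
proof -
  have "leaf_monomial q m 0 = 0" for m
    unfolding leaf_monomial_def by (rule sum.neutral) simp
  moreover have "leaf_monomial q m (x + y) = leaf_monomial q m x + leaf_monomial q m y" for m x y
    unfolding leaf_monomial_def sum.distrib[symmetric]
    by (rule sum.cong) (simp_all add: single_add distrib_left)
  ultimately show ?thesis
    unfolding leaf_operator_def by (rule sum_keys_of_sum_single) (simp_all add: assms)
qed

lemma lookup_of_nat_mult:
  "Poly_Mapping.lookup (of_nat n * P :: p_poly) x = of_nat n * Poly_Mapping.lookup P x"
  by (induction n) (simp_all add: distrib_right lookup_add)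

text \<open>
  No two pairs \<open>(m, k)\<close> share their image, so the coefficients of \<open>P\<close> appear in the image without any
  cancellation.
\<close>

lemma lookup_leaf_operator:
  assumes "q \<ge> 2" "P \<in> p_polys" "k \<in> Poly_Mapping.keys m" "k \<ge> 1" "q * k \<noteq> 2"
  shows "Poly_Mapping.lookup (leaf_operator q P) (leaf_type q m k)
    = of_nat (k * Poly_Mapping.lookup m k) * Poly_Mapping.lookup P m"
proof -
  have summand: "of_nat (k' * Poly_Mapping.lookup m' k') * Poly_Mapping.lookup
        (if q * k' \<noteq> 2 then Poly_Mapping.single (leaf_type q m' k') (Poly_Mapping.lookup P m') else 0) (leaf_type q m k)
      = (if m' = m then if k' = k then of_nat (k * Poly_Mapping.lookup m k) * Poly_Mapping.lookup P m else 0 else 0)"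
    if "m' \<in> Poly_Mapping.keys P" "k' \<in> Poly_Mapping.keys m'" for m' k'
  proof -
    have "k' \<noteq> 0" using assms(2) that unfolding p_polys_def by (cases k') auto
    then have "leaf_type q m' k' = leaf_type q m k \<longleftrightarrow> k' = k \<and> m' = m"
      using leaf_type_inj[of q k' k m' m] assms that by auto
    then show ?thesis using assms(5) by (auto simp: lookup_single when_def)
  qed
  have "Poly_Mapping.lookup (leaf_operator q P) (leaf_type q m k)
      = (\<Sum>m'\<in>Poly_Mapping.keys P. \<Sum>k'\<in>Poly_Mapping.keys m'.
          if m' = m then if k' = k then of_nat (k * Poly_Mapping.lookup m k) * Poly_Mapping.lookup P m else 0 else 0)"
    unfolding leaf_operator_def leaf_monomial_def lookup_sum lookup_of_nat_mult
    by (intro sum.cong refl summand)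
  also have "\<dots> = (\<Sum>m'\<in>Poly_Mapping.keys P. if m' = m then of_nat (k * Poly_Mapping.lookup m k) * Poly_Mapping.lookup P m else 0)"
    by (rule sum.cong) (use assms(3) in auto)
  also have "\<dots> = of_nat (k * Poly_Mapping.lookup m k) * Poly_Mapping.lookup P m"
    by (simp add: in_keys_iff)
  finally show ?thesis .
qed

lemma keys_leaf_operator_weight:
  assumes "q \<ge> 1" "P \<in> p_polys" "\<And>m. m \<in> Poly_Mapping.keys P \<Longrightarrow> weight m = n"
    and "x \<in> Poly_Mapping.keys (leaf_operator q P)"
  shows "weight x + 1 = q * n"
proof -
  have "\<exists>m\<in>Poly_Mapping.keys P. \<exists>k\<in>Poly_Mapping.keys m. x = leaf_type q m k"
  proof (rule ccontr)
    assume "\<not> ?thesis"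
    then have "Poly_Mapping.lookup (leaf_operator q P) x = 0"
      unfolding leaf_operator_def leaf_monomial_def lookup_sum lookup_of_nat_mult
      by (intro sum.neutral ballI) (auto simp: lookup_single when_def)
    with assms(4) show False by (simp add: in_keys_iff)
  qed
  then obtain m k where *: "m \<in> Poly_Mapping.keys P" "k \<in> Poly_Mapping.keys m" "x = leaf_type q m k" by blast
  then have "k \<noteq> 0" using assms(2) unfolding p_polys_def by (cases k) auto
  then show ?thesis using weight_leaf_type[of q k m] * assms by simp
qed

text \<open>
  A monomial of \<open>P\<close> can be read off its image as soon as it has a part \<open>k\<close> with \<open>qk \<noteq> 2\<close>.  The only
  monomial of weight \<open>n \<ge> 1\<close> without such a part is \<open>p\<^sub>1\<^sup>n\<close>, for \<open>q = 2\<close>.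
\<close>

lemma leaf_operator_determines:
  assumes "q \<ge> 2" "n \<ge> 1" "P \<in> p_polys" "Q \<in> p_polys"
    and "\<And>m. m \<in> Poly_Mapping.keys P \<union> Poly_Mapping.keys Q \<Longrightarrow> weight m = n"
    and "Poly_Mapping.lookup P (Poly_Mapping.single 1 n) = Poly_Mapping.lookup Q (Poly_Mapping.single 1 n)"
    and "leaf_operator q P = leaf_operator q Q"
  shows "P = Q"
proof (rule poly_mapping_eqI)
  fix m
  show "Poly_Mapping.lookup P m = Poly_Mapping.lookup Q m"
  proof (cases "m \<in> Poly_Mapping.keys P \<union> Poly_Mapping.keys Q")
    case True
    then have w: "weight m = n" and z: "0 \<notin> Poly_Mapping.keys m"
      using assms(3-5) by (auto simp: p_polys_def)
    show ?thesis
    proof (cases "\<exists>k\<in>Poly_Mapping.keys m. q * k \<noteq> 2")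
      case True
      then obtain k where k: "k \<in> Poly_Mapping.keys m" "q * k \<noteq> 2" by blast
      then have "k \<ge> 1" using z by (cases k) auto
      have "of_nat (k * Poly_Mapping.lookup m k) * Poly_Mapping.lookup P m
          = Poly_Mapping.lookup (leaf_operator q P) (leaf_type q m k)"
        by (rule lookup_leaf_operator[symmetric]) (use assms k \<open>k \<ge> 1\<close> in auto)
      also have "\<dots> = of_nat (k * Poly_Mapping.lookup m k) * Poly_Mapping.lookup Q m"
        unfolding assms(7) by (rule lookup_leaf_operator) (use assms k \<open>k \<ge> 1\<close> in auto)
      finally show ?thesis using k \<open>k \<ge> 1\<close> by (auto simp: in_keys_iff)
    next
      case False
      have "k = 1" if "k \<in> Poly_Mapping.keys m" for k
      proof -
        have "q * k = 2" using False that by auto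
        moreover have "2 * k \<le> q * k" using assms(1) by (rule mult_le_mono1)
        moreover have "k \<noteq> 0" using that z by metis
        ultimately show ?thesis by simp
      qed
      then have m: "m = Poly_Mapping.single 1 (Poly_Mapping.lookup m 1)"
        by (intro poly_mapping_eqI) (auto simp: lookup_single when_def in_keys_iff)
      then have "Poly_Mapping.lookup m 1 = n"
        using w by (metis mult_1 weight_single)
      then show ?thesis using m assms(6) by simp
    qed
  qed (auto simp: in_keys_iff)
qed

section \<open>The invariant of the leaf extension\<close>

text \<open>
  The component map of the leaf extension for a set of edges of the graph and a set \<open>T\<close> of leaf
  edges, each represented by its leaf: a vertex or an attached leaf belongs to the component of
  its (neighboring) vertex, given by \<open>\<pi>\<close>, and an unattached leaf is a component of its own.
\<close>

definition leaf_class :: "('v \<Rightarrow> 'j) \<Rightarrow> ('v \<times> nat) set \<Rightarrow> 'v \<times> nat \<Rightarrow> 'j + 'v \<times> nat" where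
  "leaf_class \<pi> T x = (if snd x = 0 \<or> x \<in> T then Inl (\<pi> (fst x)) else Inr x)"

lemma fibre_type_leaf_class:
  assumes "finite V" "q \<ge> 1" "T \<subseteq> V \<times> {1..<q}"
  shows "fibre_type (V \<times> {0..<q}) (leaf_class \<pi> T)
    = (\<Sum>j\<in>\<pi> ` V. Poly_Mapping.single (card ({v\<in>V. \<pi> v = j} \<times> {0..<q} - (V \<times> {1..<q} - T))) 1)
      + (\<Sum>x\<in>V \<times> {1..<q} - T. Poly_Mapping.single 1 1)"
proof -
  let ?W = "V \<times> {0..<q}" and ?U = "V \<times> {1..<q} - T"
  have "Inl (\<pi> v) \<in> leaf_class \<pi> T ` ?W" if "v \<in> V" for v
    using that assms(2) by (intro image_eqI[of _ _ "(v, 0)"]) (auto simp: leaf_class_def)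
  moreover have "Inr x \<in> leaf_class \<pi> T ` ?W" if "x \<in> ?U" for x
    using that by (intro image_eqI[of _ _ x]) (auto simp: leaf_class_def)
  ultimately have img: "leaf_class \<pi> T ` ?W = Inl ` \<pi> ` V \<union> Inr ` ?U"
    by (auto simp: leaf_class_def split: if_splits)
  have inl: "{x\<in>?W. leaf_class \<pi> T x = Inl j} = {v\<in>V. \<pi> v = j} \<times> {0..<q} - ?U" for j
    using assms(3) by (auto simp: leaf_class_def)
  have inr: "{x\<in>?W. leaf_class \<pi> T x = Inr y} = {y}" if "y \<in> ?U" for y
    using that by (auto simp: leaf_class_def split: if_splits)
  have "fibre_type ?W (leaf_class \<pi> T)
      = (\<Sum>j\<in>Inl ` \<pi> ` V. Poly_Mapping.single (card {x\<in>?W. leaf_class \<pi> T x = j}) 1)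
      + (\<Sum>j\<in>Inr ` ?U. Poly_Mapping.single (card {x\<in>?W. leaf_class \<pi> T x = j}) 1)"
    unfolding fibre_type_def img using assms(1) by (intro sum.union_disjoint) auto
  also have "(\<Sum>j\<in>Inl ` \<pi> ` V. Poly_Mapping.single (card {x\<in>?W. leaf_class \<pi> T x = j}) (1::nat))
      = (\<Sum>j\<in>\<pi> ` V. Poly_Mapping.single (card {x\<in>?W. leaf_class \<pi> T x = Inl j}) 1)"
    by (subst sum.reindex) (auto simp: inj_on_def)
  also have "(\<Sum>j\<in>Inr ` ?U. Poly_Mapping.single (card {x\<in>?W. leaf_class \<pi> T x = j}) (1::nat))
      = (\<Sum>y\<in>?U. Poly_Mapping.single (card {x\<in>?W. leaf_class \<pi> T x = Inr y}) 1)"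
    by (subst sum.reindex) (auto simp: inj_on_def)
  also have "\<dots> = (\<Sum>y\<in>?U. Poly_Mapping.single 1 1)"
    by (rule sum.cong) (simp_all add: inr)
  finally show ?thesis unfolding inl .
qed

text \<open>
  With all leaves attached every component has at least \<open>q \<ge> 2\<close> vertices, so \<open>p\<^sub>1\<close> does not occur.
\<close>

lemma fibre_type_all_leaves:
  assumes "finite V" "q \<ge> 2"
  shows "Poly_Mapping.lookup (fibre_type (V \<times> {0..<q}) (leaf_class \<pi> (V \<times> {1..<q}))) 1 = 0"
proof -
  have "card ({v\<in>V. \<pi> v = j} \<times> {0..<q}) \<noteq> 1" if "j \<in> \<pi> ` V" for j
    using assms(2) by (simp add: card_cartesian_product)
  then show ?thesis using assms
    by (simp add: fibre_type_leaf_class lookup_add lookup_sum lookup_single when_def)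
qed

text \<open>
  Each detached leaf is an isolated vertex; two of them leave a factor \<open>p\<^sub>1\<close> after the derivative,
  which then vanishes.
\<close>

lemma card_detached_leaves_le:
  assumes "finite V" "q \<ge> 1" "T \<subseteq> V \<times> {1..<q}"
  shows "Poly_Mapping.lookup (fibre_type (V \<times> {0..<q}) (leaf_class \<pi> T)) 1 \<ge> card (V \<times> {1..<q} - T)"
  unfolding fibre_type_leaf_class[OF assms] lookup_add lookup_sum by simp

lemma fibre_type_one_leaf_missing:
  fixes \<pi> :: "'v \<Rightarrow> 'j"
  assumes "finite V" "q \<ge> 2" "v \<in> V" "i \<in> {1..<q}"
  defines "T \<equiv> V \<times> {1..<q} - {(v, i)}" and "k \<equiv> card {u\<in>V. \<pi> u = \<pi> v}"
  shows "fibre_type (V \<times> {0..<q}) (leaf_class \<pi> T) = Poly_Mapping.single 1 1 + leaf_type q (fibre_type V \<pi>) k"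
    and "Poly_Mapping.lookup (fibre_type (V \<times> {0..<q}) (leaf_class \<pi> T)) 1 = 1 \<longleftrightarrow> q * k \<noteq> 2"
proof -
  let ?F = "\<lambda>j. {u\<in>V. \<pi> u = j}"
  have missing: "V \<times> {1..<q} - T = {(v, i)}" using assms(3,4) by (auto simp: T_def)
  have rest: "fibre_type V \<pi> - Poly_Mapping.single k 1 = (\<Sum>j\<in>\<pi> ` V - {\<pi> v}. Poly_Mapping.single (card (?F j)) 1)"
    unfolding fibre_type_def k_def using assms(1,3) by (subst sum.remove[of _ "\<pi> v"]) auto
  have "(\<Sum>j\<in>\<pi> ` V. Poly_Mapping.single (card (?F j \<times> {0..<q} - {(v, i)})) 1)
      = Poly_Mapping.single (card (?F (\<pi> v) \<times> {0..<q} - {(v, i)})) (1::nat)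
        + (\<Sum>j\<in>\<pi> ` V - {\<pi> v}. Poly_Mapping.single (card (?F j \<times> {0..<q} - {(v, i)})) 1)"
    using assms(1,3) by (intro sum.remove) auto
  also have "card (?F (\<pi> v) \<times> {0..<q} - {(v, i)}) = q * k - 1"
    using assms(1,3,4) by (subst card_Diff_subset) (auto simp: k_def card_cartesian_product mult.commute)
  also have "(\<Sum>j\<in>\<pi> ` V - {\<pi> v}. Poly_Mapping.single (card (?F j \<times> {0..<q} - {(v, i)})) (1::nat))
      = (\<Sum>j\<in>\<pi> ` V - {\<pi> v}. Poly_Mapping.single (q * card (?F j)) 1)"
  proof (rule sum.cong)
    fix j assume "j \<in> \<pi> ` V - {\<pi> v}"
    then have "?F j \<times> {0..<q} - {(v, i)} = ?F j \<times> {0..<q}" by auto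
    then show "Poly_Mapping.single (card (?F j \<times> {0..<q} - {(v, i)})) (1::nat) = Poly_Mapping.single (q * card (?F j)) 1"
      by (simp add: card_cartesian_product mult.commute)
  qed simp
  also have "\<dots> = scale_parts q (fibre_type V \<pi> - Poly_Mapping.single k 1)"
    unfolding rest using assms(1) by (simp add: scale_parts_sum_single)
  finally have classes: "(\<Sum>j\<in>\<pi> ` V. Poly_Mapping.single (card (?F j \<times> {0..<q} - {(v, i)})) 1)
      = leaf_type q (fibre_type V \<pi>) k" by (simp only: leaf_type_def)
  have "fibre_type (V \<times> {0..<q}) (leaf_class \<pi> T)
      = (\<Sum>j\<in>\<pi> ` V. Poly_Mapping.single (card (?F j \<times> {0..<q} - {(v, i)})) 1) + (\<Sum>x\<in>{(v, i)}. Poly_Mapping.single 1 1)"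
    unfolding missing[symmetric] by (rule fibre_type_leaf_class) (use assms(1,2) in \<open>auto simp: T_def\<close>)
  then show ft: "fibre_type (V \<times> {0..<q}) (leaf_class \<pi> T) = Poly_Mapping.single 1 1 + leaf_type q (fibre_type V \<pi>) k"
    unfolding classes by (simp add: add.commute)
  have "\<not> q dvd 1" using assms(2) by simp
  then have "Poly_Mapping.lookup (scale_parts q (fibre_type V \<pi> - Poly_Mapping.single k 1)) 1 = 0"
    using lookup_scale_parts(2) assms(2) by simp
  then show "Poly_Mapping.lookup (fibre_type (V \<times> {0..<q}) (leaf_class \<pi> T)) 1 = 1 \<longleftrightarrow> q * k \<noteq> 2"
    unfolding ft leaf_type_def by (auto simp: lookup_add lookup_single when_def)
qed

text \<open>
  Exponent 0 of \<open>p\<^sub>1\<close> is killed by the derivative, and an exponent above 1 leaves a factor \<open>p\<^sub>1\<close> that is set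
  to 0 afterwards.
\<close>

lemma p_set_zero_p_deriv_sum_single:
  assumes "finite I"
  shows "p_set_zero 1 (p_deriv 1 (\<Sum>i\<in>I. Poly_Mapping.single (m i) (c i)))
    = (\<Sum>i\<in>I. if Poly_Mapping.lookup (m i) 1 = 1 then Poly_Mapping.single (m i - Poly_Mapping.single 1 1) (c i) else 0)"
proof -
  let ?e = "Poly_Mapping.single 1 1 :: nat \<Rightarrow>\<^sub>0 nat"
  have d: "p_deriv 1 (\<Sum>i\<in>I. Poly_Mapping.single (m i) (c i))
      = (\<Sum>i\<in>I. Poly_Mapping.single (m i - ?e) (of_nat (Poly_Mapping.lookup (m i) 1) * c i))"
    unfolding p_deriv_def
    by (rule sum_keys_of_sum_single
        [where h = "\<lambda>m x. Poly_Mapping.single (m - ?e) (of_nat (Poly_Mapping.lookup m 1) * x)"])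
      (use assms in \<open>auto simp: distrib_left single_add\<close>)
  let ?h = "\<lambda>m x. if 1 \<notin> Poly_Mapping.keys m then Poly_Mapping.single m x else 0"
  have "p_set_zero 1 P = (\<Sum>m\<in>Poly_Mapping.keys P. ?h m (Poly_Mapping.lookup P m))" for P
    unfolding p_set_zero_def by (rule sum.inter_filter) simp
  then have z: "p_set_zero 1 (p_deriv 1 (\<Sum>i\<in>I. Poly_Mapping.single (m i) (c i)))
      = (\<Sum>i\<in>I. ?h (m i - ?e) (of_nat (Poly_Mapping.lookup (m i) 1) * c i))"
    by (simp only:) (rule sum_keys_of_sum_single[OF _ _ assms d], auto simp: single_add)
  \<comment> \<open>The exponent of \<open>p\<^sub>1\<close> after differentiation is truncated at 0; exponent 0 also yields a zero coefficient.\<close>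
  show ?thesis unfolding z
    by (rule sum.cong) (auto simp: in_keys_iff lookup_minus le_Suc_eq)
qed


text \<open>
  Only the sets \<open>T\<close> that miss a single leaf contribute.  The \<open>q - 1\<close> leaves at a vertex contribute
  equally, and the vertices are collected by the size of their component.
\<close>

lemma sum_over_attached_leaves:
  fixes \<pi> :: "'v \<Rightarrow> 'j"
  assumes "finite V" and "q \<ge> 2"
  defines "L \<equiv> V \<times> {1..<q}" and "t \<equiv> \<lambda>T. fibre_type (V \<times> {0..<q}) (leaf_class \<pi> T)"
  shows "(\<Sum>T\<in>Pow L. if Poly_Mapping.lookup (t T) 1 = 1
      then Poly_Mapping.single (t T - Poly_Mapping.single 1 1) (c * (-1) ^ card T) else 0)
    = Poly_Mapping.single 0 (of_nat (q - 1) * (-1) ^ (card L - 1)) * leaf_monomial q (fibre_type V \<pi>) c"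
proof -
  let ?s = "\<lambda>T. if Poly_Mapping.lookup (t T) 1 = 1
      then Poly_Mapping.single (t T - Poly_Mapping.single 1 1) (c * (-1) ^ card T) else 0"
  let ?k = "\<lambda>v. card {u\<in>V. \<pi> u = \<pi> v}"
  let ?g = "\<lambda>k. if q * k \<noteq> 2 then Poly_Mapping.single (leaf_type q (fibre_type V \<pi>) k) c else 0"
  let ?d = "Poly_Mapping.single 0 ((-1) ^ (card L - 1)) :: p_poly"
  have "finite L" using assms(1) by (simp add: L_def)
  have "sum ?s (Pow L) = sum ?s ((\<lambda>x. L - {x}) ` L)"
  proof (rule sum.mono_neutral_right)
    show "\<forall>T\<in>Pow L - (\<lambda>x. L - {x}) ` L. ?s T = 0"
    proof
      fix T assume T: "T \<in> Pow L - (\<lambda>x. L - {x}) ` L"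
      have "card (L - T) \<noteq> 1"
      proof
        assume "card (L - T) = 1"
        then obtain x where "L - T = {x}" by (auto simp: card_1_singleton_iff)
        then have "T = L - {x}" "x \<in> L" using T by auto
        then show False using T by blast
      qed
      have "Poly_Mapping.lookup (t T) 1 \<noteq> 1"
      proof (cases "T = L")
        case True
        then show ?thesis using fibre_type_all_leaves[OF assms(1,2), of \<pi>] by (simp add: t_def L_def)
      next
        case False
        then have "L - T \<noteq> {}" using T by auto
        then have "card (L - T) \<noteq> 0" using \<open>finite L\<close> by simp
        then have "card (L - T) \<ge> 2" using \<open>card (L - T) \<noteq> 1\<close> by linarith
        then show ?thesis
          using card_detached_leaves_le[of V q T \<pi>] assms(1,2) T by (simp add: t_def L_def)
      qed
      then show "?s T = 0" by simp
    qed
  qed (use \<open>finite L\<close> in auto)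
  also have "\<dots> = (\<Sum>x\<in>L. ?s (L - {x}))"
    by (subst sum.reindex) (auto simp: inj_on_def)
  also have "\<dots> = (\<Sum>x\<in>L. ?d * ?g (?k (fst x)))"
  proof (rule sum.cong)
    fix x assume "x \<in> L"
    then obtain v i where x: "x = (v, i)" "v \<in> V" "i \<in> {1..<q}" by (auto simp: L_def)
    have "card (L - {x}) = card L - 1" using \<open>x \<in> L\<close> by simp
    then show "?s (L - {x}) = ?d * ?g (?k (fst x))"
      using fibre_type_one_leaf_missing[OF assms(1,2) x(2,3), of \<pi>]
      by (simp add: x t_def L_def mult_single mult.commute)
  qed simp
  also have "\<dots> = ?d * (\<Sum>x\<in>L. ?g (?k (fst x)))"
    by (simp only: sum_distrib_left)
  also have "(\<Sum>x\<in>L. ?g (?k (fst x))) = (\<Sum>v\<in>V. \<Sum>i\<in>{1..<q}. ?g (?k v))"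
    unfolding L_def by (simp only: sum.cartesian_product split_def)
  also have "\<dots> = of_nat (q - 1) * (\<Sum>v\<in>V. ?g (?k v))"
    by (simp only: sum_constant card_atLeastLessThan sum_distrib_left)
  also have "(\<Sum>v\<in>V. ?g (?k v)) = leaf_monomial q (fibre_type V \<pi>) c"
    unfolding leaf_monomial_def by (rule sum_card_fibre) fact
  also have "?d * (of_nat (q - 1) * leaf_monomial q (fibre_type V \<pi>) c)
      = Poly_Mapping.single 0 (of_nat (q - 1) * (-1) ^ (card L - 1)) * leaf_monomial q (fibre_type V \<pi>) c"
  proof -
    have "?d * of_nat (q - 1) = Poly_Mapping.single 0 (of_nat (q - 1) * (-1) ^ (card L - 1))"
      unfolding single_of_nat[symmetric] mult_single by (simp add: mult.commute)
    then show ?thesis by (simp only: mult.assoc[symmetric])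
  qed
  finally show ?thesis .
qed

lemma proper_colorings_leaf_extension:
  assumes "pair_graph G" "q \<ge> 1"
  shows "\<kappa> \<in> proper_colorings (leaf_extension q G) \<longleftrightarrow> \<kappa> \<in> pverts G \<times> {0..<q} \<rightarrow>\<^sub>E {1..}
    \<and> (\<forall>e\<in>parcs G. \<not> \<kappa> (fst e, 0) = \<kappa> (snd e, 0))
    \<and> (\<forall>x\<in>pverts G \<times> {1..<q}. \<not> \<kappa> x = \<kappa> (fst x, 0))"
proof -
  have arcs: "parcs (leaf_extension q G) = (\<lambda>e. ((fst e, 0), (snd e, 0))) ` parcs G
      \<union> (\<lambda>x. ((fst x, 0), x)) ` (pverts G \<times> {1..<q}) \<union> (\<lambda>x. (x, (fst x, 0))) ` (pverts G \<times> {1..<q})"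
    unfolding leaf_extension_def by (force simp: image_iff)
  have "(\<forall>(u, v)\<in>parcs (leaf_extension q G). \<kappa> u \<noteq> \<kappa> v)
    \<longleftrightarrow> (\<forall>e\<in>parcs G. \<not> \<kappa> (fst e, 0) = \<kappa> (snd e, 0))
      \<and> (\<forall>x\<in>pverts G \<times> {1..<q}. \<not> \<kappa> x = \<kappa> (fst x, 0))"
    unfolding arcs ball_Un ball_simps(9) prod.case by metis
  then show ?thesis by (simp add: proper_colorings_def) (simp add: leaf_extension_def)
qed

lemma constant_on_leaf_class_iff:
  assumes "S \<subseteq> V \<times> V" "T \<subseteq> V \<times> {1..<q}" "q \<ge> 1"
  shows "constant_on_fibres (V \<times> {0..<q}) (leaf_class (reach_class S) T) \<kappa>
    \<longleftrightarrow> (\<forall>e\<in>S. \<kappa> (fst e, 0) = \<kappa> (snd e, 0)) \<and> (\<forall>x\<in>T. \<kappa> x = \<kappa> (fst x, 0))"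
proof -
  have "(\<forall>e\<in>S. \<kappa> (fst e, 0) = \<kappa> (snd e, 0)) \<longleftrightarrow> constant_on_fibres V (reach_class S) (\<lambda>v. \<kappa> (v, 0))"
    using constant_on_reach_class_iff[OF assms(1), of "\<lambda>v. \<kappa> (v, 0)"] by (simp add: split_def)
  moreover have "constant_on_fibres (V \<times> {0..<q}) (leaf_class (reach_class S) T) \<kappa>
    \<longleftrightarrow> constant_on_fibres V (reach_class S) (\<lambda>v. \<kappa> (v, 0)) \<and> (\<forall>x\<in>T. \<kappa> x = \<kappa> (fst x, 0))"
    (is "?l \<longleftrightarrow> ?r1 \<and> ?r2")
  proof (intro iffI conjI)
    assume l: ?l
    show ?r1
      unfolding constant_on_fibres_def
    proof (intro ballI impI)
      fix u v assume "u \<in> V" "v \<in> V" "reach_class S u = reach_class S v"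
      then show "\<kappa> (u, 0) = \<kappa> (v, 0)"
        using l[unfolded constant_on_fibres_def, rule_format, of "(u, 0)" "(v, 0)"] assms(3)
        by (simp add: leaf_class_def)
    qed
    show ?r2
    proof
      fix x assume x: "x \<in> T"
      then have "x \<in> V \<times> {0..<q}" "(fst x, 0) \<in> V \<times> {0..<q}" using assms(2,3) by auto
      then show "\<kappa> x = \<kappa> (fst x, 0)"
        using l[unfolded constant_on_fibres_def, rule_format, of x "(fst x, 0)"] x
        by (simp add: leaf_class_def)
    qed
  next
    assume r: "?r1 \<and> ?r2"
    have center: "\<kappa> x = \<kappa> (fst x, 0)" if "snd x = 0 \<or> x \<in> T" for x
      using r that by (cases x) auto
    show ?l
      unfolding constant_on_fibres_def
    proof (intro ballI impI)
      fix x y assume xy: "x \<in> V \<times> {0..<q}" "y \<in> V \<times> {0..<q}"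
        and eq: "leaf_class (reach_class S) T x = leaf_class (reach_class S) T y"
      show "\<kappa> x = \<kappa> y"
      proof (cases "snd x = 0 \<or> x \<in> T")
        case True
        then have y: "snd y = 0 \<or> y \<in> T" and "reach_class S (fst x) = reach_class S (fst y)"
          using eq by (auto simp: leaf_class_def split: if_splits)
        moreover have "fst x \<in> V" "fst y \<in> V" using xy by auto
        ultimately have "\<kappa> (fst x, 0) = \<kappa> (fst y, 0)"
          using r unfolding constant_on_fibres_def by blast
        then show ?thesis using center[OF True] center[OF y] by simp
      next
        case False
        then show ?thesis using eq by (auto simp: leaf_class_def split: if_splits)
      qed
    qed
  qed
  ultimately show ?thesis by simp
qed

text \<open>
  The edges of the leaf extension are those of the graph and the leaf edges.  Inclusion-exclusion over
  both kinds gives the expansion of its chromatic symmetric function; for each set of edges of the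
  graph, the sum over the leaf edges has been evaluated above.
\<close>

lemma Phi_leaf_extension:
  assumes "pair_graph G" and "q \<ge> 2"
  shows "Phi (leaf_extension q G)
    = Poly_Mapping.single 0 (of_nat (q - 1) * (-1) ^ (card (pverts G) * (q - 1) - 1))
      * leaf_operator q (chromatic_p_poly G)"
proof -
  let ?V = "pverts G" and ?L = "pverts G \<times> {1..<q}" and ?I = "Pow (parcs G) \<times> Pow (pverts G \<times> {1..<q})"
  let ?W = "pverts G \<times> {0..<q}"
  let ?\<pi> = "\<lambda>(S, T). leaf_class (reach_class S) T"
  let ?c = "\<lambda>(S, T). (-1) ^ card S * (-1) ^ card T :: rat"
  let ?C = "Poly_Mapping.single 0 (of_nat (q - 1) * (-1) ^ (card ?V * (q - 1) - 1)) :: p_poly"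
  note ar = arcs_subset[OF assms(1)]
  have W: "pverts (leaf_extension q G) = ?W" by (simp add: leaf_extension_def)
  have fin: "finite ?W" "finite ?L" "finite ?I" using ar by auto
  have cards: "card ?L = card ?V * (q - 1)" by (simp add: card_cartesian_product)
  have ind: "(if \<kappa> \<in> proper_colorings (leaf_extension q G) then 1 else 0 :: rat)
      = (\<Sum>i\<in>?I. ?c i * (if constant_on_fibres ?W (?\<pi> i) \<kappa> then 1 else 0))"
    if \<kappa>: "\<kappa> \<in> ?W \<rightarrow>\<^sub>E {1..}" for \<kappa>
  proof -
    let ?a = "\<lambda>e. \<kappa> (fst e, 0) = \<kappa> (snd e, 0)" and ?b = "\<lambda>x. \<kappa> x = \<kappa> (fst x, 0)"
    have "(if \<kappa> \<in> proper_colorings (leaf_extension q G) then 1 else 0 :: rat)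
        = (if \<forall>e\<in>parcs G. \<not> ?a e then 1 else 0) * (if \<forall>x\<in>?L. \<not> ?b x then 1 else 0)"
      using \<kappa> assms by (simp add: proper_colorings_leaf_extension)
    also have "\<dots> = (\<Sum>S\<in>Pow (parcs G). (-1) ^ card S * (if \<forall>e\<in>S. ?a e then 1 else 0))
        * (\<Sum>T\<in>Pow ?L. (-1) ^ card T * (if \<forall>x\<in>T. ?b x then 1 else 0))"
      by (simp only: indicator_inclusion_exclusion[OF ar(3)] indicator_inclusion_exclusion[OF fin(2)])
    also have "\<dots> = (\<Sum>(S, T)\<in>?I. ((-1) ^ card S * (if \<forall>e\<in>S. ?a e then 1 else 0))
        * ((-1) ^ card T * (if \<forall>x\<in>T. ?b x then 1 else 0)))"
      by (simp only: sum_product sum.cartesian_product)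
    also have "\<dots> = (\<Sum>i\<in>?I. ?c i * (if constant_on_fibres ?W (?\<pi> i) \<kappa> then 1 else 0))"
    proof (rule sum.cong)
      fix i assume "i \<in> ?I"
      then obtain S T where i: "i = (S, T)" "S \<subseteq> ?V \<times> ?V" "T \<subseteq> ?L" using ar(1) by blast
      have "constant_on_fibres ?W (?\<pi> i) \<kappa> \<longleftrightarrow> (\<forall>e\<in>S. ?a e) \<and> (\<forall>x\<in>T. ?b x)"
        unfolding i(1) prod.case using assms(2) by (intro constant_on_leaf_class_iff i(2,3)) simp
      then show "(case i of (S, T) \<Rightarrow> ((-1) ^ card S * (if \<forall>e\<in>S. ?a e then 1 else 0))
          * ((-1) ^ card T * (if \<forall>x\<in>T. ?b x then 1 else 0)))
          = ?c i * (if constant_on_fibres ?W (?\<pi> i) \<kappa> then 1 else 0)"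
        unfolding i(1) prod.case by simp
    qed simp
    finally show ?thesis .
  qed
  have "p_expansion (chromatic_symmetric_function (leaf_extension q G))
      = (\<Sum>i\<in>?I. Poly_Mapping.single (fibre_type ?W (?\<pi> i)) (?c i))"
    by (rule p_expansion_chromatic_symmetric_function(3)[of "leaf_extension q G" ?I ?c ?\<pi>, unfolded W])
      (use fin ind in auto)
  then have "Phi (leaf_extension q G) = (\<Sum>i\<in>?I. if Poly_Mapping.lookup (fibre_type ?W (?\<pi> i)) 1 = 1
      then Poly_Mapping.single (fibre_type ?W (?\<pi> i) - Poly_Mapping.single 1 1) (?c i) else 0)"
    unfolding Phi_def by (simp only: p_set_zero_p_deriv_sum_single[OF fin(3)])
  also have "\<dots> = (\<Sum>S\<in>Pow (parcs G). \<Sum>T\<in>Pow ?L.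
      if Poly_Mapping.lookup (fibre_type ?W (leaf_class (reach_class S) T)) 1 = 1
      then Poly_Mapping.single (fibre_type ?W (leaf_class (reach_class S) T) - Poly_Mapping.single 1 1)
        ((-1) ^ card S * (-1) ^ card T) else 0)"
    by (simp only: sum.cartesian_product split_def)
  also have "\<dots> = (\<Sum>S\<in>Pow (parcs G). ?C * leaf_monomial q (fibre_type ?V (reach_class S)) ((-1) ^ card S))"
    by (simp only: sum_over_attached_leaves[OF ar(2) assms(2)] cards)
  also have "\<dots> = ?C * leaf_operator q (chromatic_p_poly G)"
    unfolding chromatic_p_poly_def using ar(3)
    by (simp only: leaf_operator_sum_single finite_Pow_iff sum_distrib_left)
  finally show ?thesis .
qed

section \<open>Recovering the chromatic symmetric function\<close>

lemma weight_chromatic_p_poly: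
  assumes "pair_graph G" and "m \<in> Poly_Mapping.keys (chromatic_p_poly G)"
  shows "weight m = card (pverts G)"
proof -
  have "Poly_Mapping.keys (chromatic_p_poly G) \<subseteq> (\<Union>S\<in>Pow (parcs G).
      Poly_Mapping.keys (Poly_Mapping.single (fibre_type (pverts G) (reach_class S)) ((-1 :: rat) ^ card S)))"
    unfolding chromatic_p_poly_def by (rule keys_sum)
  with assms(2) obtain S where "m = fibre_type (pverts G) (reach_class S)" by (auto split: if_splits)
  then show ?thesis using arcs_subset(2)[OF assms(1)] by (simp add: weight_fibre_type)
qed

lemma single_0_mult_cancel:
  fixes P Q :: p_poly
  assumes "c \<noteq> 0" and "Poly_Mapping.single 0 c * P = Poly_Mapping.single 0 c * Q"
  shows "P = Q"
proof -
  have unit: "Poly_Mapping.single 0 (inverse c) * (Poly_Mapping.single 0 c * R) = R" for R :: p_poly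
    using assms(1) by (simp add: mult.assoc[symmetric] mult_single)
  show ?thesis using arg_cong[OF assms(2), of "(*) (Poly_Mapping.single 0 (inverse c))"] by (simp only: unit)
qed

lemma leaf_operator_0 [simp]: "leaf_operator q 0 = 0"
  by (simp add: leaf_operator_def)

text \<open>
  For \<open>q > 2\<close> the monomial \<open>p\<^sub>1\<^sup>n\<close>, whose coefficient is 1, has a nonzero image.  For \<open>q = 2\<close> vanishing
  forces the polynomial to be \<open>p\<^sub>1\<^sup>n\<close>, so the graph has no edges and, being connected, is a single vertex.
\<close>

lemma chromatic_p_poly_if_leaf_operator_0:
  assumes "pair_graph G" "Digraph_Component.connected (with_proj G)" "q \<ge> 2"
    and "leaf_operator q (chromatic_p_poly G) = 0"
  shows "chromatic_p_poly G = Poly_Mapping.single (Poly_Mapping.single 1 1) 1"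
proof -
  let ?n = "card (pverts G)"
  have n: "?n \<ge> 1" using assms(1,2) by (rule connected_card_pos)
  let ?e = "Poly_Mapping.single 1 ?n :: nat \<Rightarrow>\<^sub>0 nat"
  have one: "Poly_Mapping.lookup (chromatic_p_poly G) ?e = 1"
    by (rule lookup_chromatic_p_poly_isolated) fact
  have "q = 2"
  proof (rule ccontr)
    assume "q \<noteq> 2"
    have "Poly_Mapping.lookup (leaf_operator q (chromatic_p_poly G)) (leaf_type q ?e 1)
        = of_nat (1 * Poly_Mapping.lookup ?e 1) * Poly_Mapping.lookup (chromatic_p_poly G) ?e"
      by (rule lookup_leaf_operator) (use assms(3) n \<open>q \<noteq> 2\<close> chromatic_p_poly_represents(1)[OF assms(1)] in auto)
    then show False using n one assms(4) by simp
  qed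
  have eq: "chromatic_p_poly G = Poly_Mapping.single ?e 1"
  proof (rule leaf_operator_determines)
    have "leaf_operator q (Poly_Mapping.single ?e 1) = 0"
      using n by (simp add: leaf_operator_def leaf_monomial_def \<open>q = 2\<close>)
    then show "leaf_operator q (chromatic_p_poly G) = leaf_operator q (Poly_Mapping.single ?e 1)"
      using assms(4) by simp
    show "Poly_Mapping.single ?e 1 \<in> p_polys" using n by (simp add: p_polys_def)
    fix m assume "m \<in> Poly_Mapping.keys (chromatic_p_poly G) \<union> Poly_Mapping.keys (Poly_Mapping.single ?e (1::rat))"
    then show "weight m = ?n" using weight_chromatic_p_poly[OF assms(1)] by auto
  qed (use assms(3) n one chromatic_p_poly_represents(1)[OF assms(1)] in auto)
  have "?n = 1"
    using connected_edgeless[OF assms(2) edgeless_if_chromatic_p_poly_trivial[OF assms(1) eq]] .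
  then show ?thesis using eq by simp
qed

theorem theorem2:
  fixes q :: nat and G :: "'a pair_pre_digraph" and H :: "'b pair_pre_digraph"
  assumes "q \<ge> 2"
    and "pair_graph G" and "Digraph_Component.connected (with_proj G)"
    and "pair_graph H" and "Digraph_Component.connected (with_proj H)"
  shows "Phi (leaf_extension q G) = Phi (leaf_extension q H)
     \<longleftrightarrow> chromatic_symmetric_function G = chromatic_symmetric_function H"
proof -
  let ?P = "chromatic_p_poly G" and ?Q = "chromatic_p_poly H"
  let ?n = "card (pverts G)" and ?n' = "card (pverts H)"
  let ?c = "\<lambda>n. of_nat (q - 1) * (-1) ^ (n * (q - 1) - 1) :: rat"
  have c: "?c n \<noteq> 0" for n using assms(1) by simp
  note P = chromatic_p_poly_represents[OF assms(2)] and Q = chromatic_p_poly_represents[OF assms(4)]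
  note Phi = Phi_leaf_extension[OF assms(2,1)] Phi_leaf_extension[OF assms(4,1)]
  have n: "?n \<ge> 1" using assms(2,3) by (rule connected_card_pos)
  show ?thesis
  proof
    assume eq: "Phi (leaf_extension q G) = Phi (leaf_extension q H)"
    have "?P = ?Q"
    proof (cases "leaf_operator q ?P = 0")
      case True
      then have "Poly_Mapping.single 0 (?c ?n') * leaf_operator q ?Q = Poly_Mapping.single 0 (?c ?n') * 0"
        using eq unfolding Phi by simp
      then have "leaf_operator q ?Q = 0" by (rule single_0_mult_cancel[OF c])
      then show ?thesis
        using chromatic_p_poly_if_leaf_operator_0[OF assms(2,3,1) True] chromatic_p_poly_if_leaf_operator_0[OF assms(4,5,1)] by simp
    next
      case False
      then have "Phi (leaf_extension q G) \<noteq> 0"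
        unfolding Phi using single_0_mult_cancel[OF c, of ?n "leaf_operator q ?P" 0] by auto
      \<comment> \<open>The weight \<open>qn - 1\<close> of any monomial of \<open>\<Phi>\<close> yields \<open>n\<close>, and thereby the scalar factor in \<open>\<Phi>\<close>.\<close>
      then obtain x where x: "x \<in> Poly_Mapping.keys (Phi (leaf_extension q G))"
        by fastforce
      have keys: "x \<in> Poly_Mapping.keys R" if "x \<in> Poly_Mapping.keys (Poly_Mapping.single 0 d * R)" for d and R :: p_poly
        using that keys_mult[of "Poly_Mapping.single 0 d" R] by (auto split: if_splits)
      have "x \<in> Poly_Mapping.keys (leaf_operator q ?P)"
        using x unfolding Phi(1) by (rule keys)
      then have "weight x + 1 = q * ?n"
        using keys_leaf_operator_weight[OF _ P(1) weight_chromatic_p_poly[OF assms(2)]] assms(1) by simp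
      moreover have "x \<in> Poly_Mapping.keys (leaf_operator q ?Q)"
        using x unfolding eq Phi(2) by (rule keys)
      then have "weight x + 1 = q * ?n'"
        using keys_leaf_operator_weight[OF _ Q(1) weight_chromatic_p_poly[OF assms(4)]] assms(1) by simp
      ultimately have nn: "?n = ?n'" using assms(1) by simp
      have "leaf_operator q ?P = leaf_operator q ?Q"
        using eq unfolding Phi nn by (rule single_0_mult_cancel[OF c])
      then show ?thesis
        using leaf_operator_determines[OF assms(1) n P(1) Q(1)]
          weight_chromatic_p_poly[OF assms(2)] weight_chromatic_p_poly[OF assms(4)]
          lookup_chromatic_p_poly_isolated[OF assms(2)] lookup_chromatic_p_poly_isolated[OF assms(4)] nn
        by (metis Un_iff)
    qed
    then show "chromatic_symmetric_function G = chromatic_symmetric_function H"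
      by (simp add: P(2) Q(2))
  next
    assume "chromatic_symmetric_function G = chromatic_symmetric_function H"
    then have "p_eval ?P = p_eval ?Q" by (simp only: P(2) Q(2))
    then have PQ: "?P = ?Q"
      using p_expansion_p_eval[OF P(1)] p_expansion_p_eval[OF Q(1)] by metis
    have "Poly_Mapping.single 1 ?n \<in> Poly_Mapping.keys ?P"
      using lookup_chromatic_p_poly_isolated[OF assms(2)] by (simp add: in_keys_iff)
    then have "?n' = weight (Poly_Mapping.single 1 ?n)"
      unfolding PQ by (rule weight_chromatic_p_poly[OF assms(4), symmetric])
    then have "?n = ?n'" by simp
    then show "Phi (leaf_extension q G) = Phi (leaf_extension q H)"
      unfolding Phi using PQ by simp
  qed
qed

end
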